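(* Let $d\geq 1$, $h>0$ and $u\in H^r((h\mathbb{Z})^d)$ for some $r\in\mathbb{R}$. Let $s\in(0,1)$ and assume that $$u=0=(-\Delta_{\mathrm d})^s u\quad\text{in }\{x\in(h\mathbb{Z})^d:\ x_d\ge 0\}.$$ Then $u\equiv 0$ in $(h\mathbb{Z})^d$.
   Context: Here $(h\mathbb{Z})^d=\{hj: j\in\mathbb{Z}^d\}$ and $u_j:=u(hj)$. For $s\in(0,1)$ the fractional discrete Laplacian is $$(-\Delta_{\mathrm d})^s u_j=\sum_{m\in\mathbb{Z}^d,\,m\ne j}(u_j-u_m)K_s^h(j-m),\qquad K_s^h(m)=\frac{1}{h^{2s}|\Gamma(-s)|}\int_0^\infty e^{-2dt}\prod_{i=1}^d I_{m_i}(2t)\,\frac{dt}{t^{1+s}}\quad (m\neq 0),$$ with $K_s^h(0)=0$, where $I_k$ is the modified Bessel function of the first kind of order $k\in\mathbb{Z}$ (so $I_{-k}=I_k$). The Fourier transform of $u:(h\mathbb{Z})^d\to\mathbb{R}$ is $\mathcal{F}u(\xi)=\sum_{k\in\mathbb{Z}^d}u_k e^{-ih\xi\cdot k}$, $\xi\in[-\pi/h,\pi/h)^d$. For $r\in\mathbb{R}$, $\|u\|_{H^r((h\mathbb{Z})^d)}:=\big\|\mathcal{F}^{-1}\big[(1+h^{-2}\sum_{k=1}^d|\sin(h\xi_k)|^2)^{r/2}\mathcal{F}u\big]\big\|_{L^2((h\mathbb{Z})^d)}$, and $H^r((h\mathbb{Z})^d)$ is the closure of the finitely supported functions on $(h\mathbb{Z})^d$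 with respect to this norm. *)

theory Defs
  imports "HOL-Analysis.Analysis"
begin

text \<open>
  A function \<open>u\<close> on the lattice \<open>(h\<int>)\<^sup>d\<close> is represented by its samples
  \<open>u j = u(h j)\<close>, \<open>j \<in> \<int>\<^sup>d\<close>. The dimension is \<open>CARD('d) \<ge> 1\<close>.
\<close>

text \<open>
  The modified Bessel function of the first kind of integer order, by the power series
  \<open>I\<^sub>\<nu>(x) = \<Sum>n. (x/2)\<^bsup>2n+\<nu>\<^esup> / (n! \<Gamma>(n+\<nu>+1))\<close> for \<open>\<nu> \<ge> 0\<close>,
  and \<open>I\<^bsub>-k\<^esub> = I\<^sub>k\<close>.
\<close>

definition bessel_I :: "int \<Rightarrow> real \<Rightarrow> real" where
  "bessel_I k x =
     (\<Sum>n. (x / 2) ^ (2 * n + nat \<bar>k\<bar>) / (fact n * Gamma (real n + real (nat \<bar>k\<bar>) + 1)))"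

definition frac_kernel :: "real \<Rightarrow> real \<Rightarrow> int ^ 'd \<Rightarrow> real" where
  "frac_kernel h s m =
     (if m = 0 then 0
      else 1 / (h powr (2 * s) * \<bar>Gamma (- s)\<bar>) *
        (LBINT t:{0<..}. exp (- 2 * real CARD('d) * t) *
            (\<Prod>i\<in>UNIV. bessel_I (m $ i) (2 * t)) / t powr (1 + s)))"

definition frac_laplacian :: "real \<Rightarrow> real \<Rightarrow> (int ^ 'd \<Rightarrow> real) \<Rightarrow> int ^ 'd \<Rightarrow> real" where
  "frac_laplacian h s u j =
     (\<Sum>\<^sub>\<infinity>m\<in>UNIV - {j}. (u j - u m) * frac_kernel h s (j - m))"

definition phase :: "real \<Rightarrow> real ^ 'd \<Rightarrow> int ^ 'd \<Rightarrow> real" where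
  "phase h \<xi> k = h * (\<Sum>i\<in>UNIV. \<xi> $ i * of_int (k $ i))"

definition freq_box :: "real \<Rightarrow> (real ^ 'd) set" where
  "freq_box h = {\<xi>. \<forall>i. - pi / h \<le> \<xi> $ i \<and> \<xi> $ i < pi / h}"

text \<open>
  The transform below is only meaningful for absolutely summable \<open>u\<close> (otherwise the
  unconditional sum has the default value 0). It is only applied to finitely supported
  functions.
\<close>

definition fourier :: "real \<Rightarrow> (int ^ 'd \<Rightarrow> real) \<Rightarrow> real ^ 'd \<Rightarrow> complex" where
  "fourier h u \<xi> = (\<Sum>\<^sub>\<infinity>k. of_real (u k) * exp (- \<i> * of_real (phase h \<xi> k)))"

definition inv_fourier :: "real \<Rightarrow> (real ^ 'd \<Rightarrow> complex) \<Rightarrow> int ^ 'd \<Rightarrow> complex" where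
  "inv_fourier h F k =
     of_real ((h / (2 * pi)) ^ CARD('d)) *
       (LINT \<xi>:freq_box h|lborel. F \<xi> * exp (\<i> * of_real (phase h \<xi> k)))"

definition lattice_L2_norm :: "real \<Rightarrow> (int ^ 'd \<Rightarrow> complex) \<Rightarrow> real" where
  "lattice_L2_norm h v = sqrt (h ^ CARD('d) * (\<Sum>\<^sub>\<infinity>k. (cmod (v k))\<^sup>2))"

definition sobolev_weight :: "real \<Rightarrow> real \<Rightarrow> real ^ 'd \<Rightarrow> real" where
  "sobolev_weight r h \<xi> =
     (1 + h powi (-2) * (\<Sum>k\<in>UNIV. \<bar>sin (h * \<xi> $ k)\<bar>\<^sup>2)) powr (r / 2)"

definition sobolev_norm :: "real \<Rightarrow> real \<Rightarrow> (int ^ 'd \<Rightarrow> real) \<Rightarrow> real" where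
  "sobolev_norm r h u =
     lattice_L2_norm h (inv_fourier h (\<lambda>\<xi>. of_real (sobolev_weight r h \<xi>) * fourier h u \<xi>))"

definition fin_supp :: "(int ^ 'd \<Rightarrow> real) \<Rightarrow> bool" where
  "fin_supp u \<longleftrightarrow> finite {j. u j \<noteq> 0}"

text \<open>
  \<open>H\<^sup>r((h\<int>)\<^sup>d)\<close> is the completion of the finitely supported functions under the Sobolev norm,
  realised as a space of functions: its elements are the pointwise limits of Cauchy sequences.
  Since \<open>sobolev_weight\<close> is bounded above and away from 0 for fixed \<open>h\<close>, evaluation at a
  lattice point is continuous in the norm, so every Cauchy sequence converges pointwise, and
  two Cauchy sequences have the same pointwise limit iff their difference tends to 0 in norm.
\<close>

definition sobolev_space :: "real \<Rightarrow> real \<Rightarrow> (int ^ 'd \<Rightarrow> real) set" where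
  "sobolev_space r h =
     {u. \<exists>\<phi> :: nat \<Rightarrow> int ^ 'd \<Rightarrow> real.
           (\<forall>n. fin_supp (\<phi> n)) \<and>
           (\<forall>\<epsilon>>0. \<exists>N. \<forall>m\<ge>N. \<forall>n\<ge>N. sobolev_norm r h (\<lambda>j. \<phi> m j - \<phi> n j) < \<epsilon>) \<and>
           (\<forall>j. (\<lambda>n. \<phi> n j) \<longlonglongrightarrow> u j)}"

end

theory Submission
  imports Defs
begin

text \<open>
Let \<open>P\<^sub>t\<close> be the heat kernel of \<open>\<int>\<^sup>d\<close>, let \<open>G\<^sub>\<mu>(m) = \<integral> e\<^bsup>-\<mu>t\<^esup> P\<^sub>t(m) dt\<close> be the kernel of the
resolvent \<open>(\<mu> - \<Delta>)\<inverse>\<close>, and let \<open>v\<^sub>\<mu> = G\<^sub>\<mu> * u\<close>. The factor \<open>t\<^bsup>-1-s\<^esup>\<close> in the fractional kernel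
is a mixture of exponentials, \<open>\<Gamma>(1+s) t\<^bsup>-1-s\<^esup> = \<integral> \<mu>\<^sup>s e\<^bsup>-\<mu>t\<^esup> d\<mu>\<close>. Off the diagonal the fractional
kernel is therefore a positive multiple of \<open>\<integral> \<mu>\<^sup>s G\<^sub>\<mu> d\<mu>\<close> (\<open>frac_kernel_subordination\<close>), and
a statement about it splits into statements about the local operators \<open>\<mu> - \<Delta>\<close>.

Let \<open>R\<close> be the reflection \<open>j\<^sub>l \<mapsto> -1 - j\<^sub>l\<close>, which exchanges the half-space \<open>j\<^sub>l \<ge> 0\<close> with its
complement. On the half-space \<open>u\<close> vanishes, so the fractional Laplacian of \<open>u\<close> there is minus the
convolution of \<open>u\<close> with the kernel, and this convolution vanishes as well. Pairing it with
\<open>u \<circ> R\<close>, which is supported in the half-space, gives \<open>\<integral> \<mu>\<^sup>s Q(\<mu>) d\<mu> = 0\<close> for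
\<open>Q(\<mu>) = \<Sum>\<^sub>j u(Rj) v\<^sub>\<mu>(j)\<close> (\<open>reflected_pairing_integral\<close>).
The resolvent is reflection positive, in the strong form that \<open>Q(\<mu>)\<close> is at least \<open>2\<mu>\<close> times the
sum of \<open>v\<^sub>\<mu>\<^sup>2\<close> over the half-space (\<open>reflection_positivity\<close>). Hence \<open>v\<^sub>\<mu> = 0\<close> on the half-space for
almost every \<open>\<mu> > 0\<close>. Positivity is a property of the resolvent: at a fixed time the
heat kernel lacks it, since \<open>I\<^sub>1 I\<^sub>3 < I\<^sub>2\<^sup>2\<close>.

From here \<open>u\<close> is recovered layer by layer (\<open>square_summable_unique_continuation\<close>). If \<open>u\<close> and
\<open>v\<^sub>\<mu>\<close> vanish for \<open>j\<^sub>l \<ge> -n\<close>, then the equation \<open>(\<mu> - \<Delta>) v\<^sub>\<mu> = u\<close> on the layer \<open>j\<^sub>l = -n\<close> says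
that \<open>v\<^sub>\<mu>\<close> vanishes on the layer \<open>-n-1\<close>. On that layer the same equation then reads
\<open>u(j) = - v\<^sub>\<mu>(j - e\<^sub>l)\<close>, whose right-hand side is \<open>O(1/\<mu>)\<close>, so \<open>u(j) = 0\<close> on letting \<open>\<mu> \<rightarrow> \<infinity>\<close>.

All this takes place in \<open>\<ell>\<^sup>2\<close>. For fixed \<open>h\<close> the Sobolev weight is bounded away from zero, so the
Sobolev norm dominates the \<open>\<ell>\<^sup>2\<close> norm by Parseval's identity
(\<open>sobolev_space_square_summable\<close>). Only the inequality that expresses completeness of the
characters is at stake, and only for a trigonometric polynomial times the weight. The weight is
a continuous function of the trigonometric polynomial \<open>\<Sum>\<^sub>k sin\<^sup>2(h\<xi>\<^sub>k)\<close>, so Weierstrass'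
theorem in one variable provides the required uniform approximation.
\<close>

section \<open>Modified Bessel functions\<close>

text \<open>
The function \<open>1/\<Gamma>(z+1)\<close> at the integers. Its zeros at the negative integers make the recursion
below valid without exception, and with it the recursion for the Bessel coefficients.
\<close>

definition inv_fact :: "int \<Rightarrow> real" where
  "inv_fact z = (if z < 0 then 0 else 1 / fact (nat z))"

lemma inv_fact_recursion: "of_int z * inv_fact z = inv_fact (z - 1)"
proof (cases "z > 0")
  case True
  then have "nat z = Suc (nat (z - 1))" by simp
  then have "fact (nat z) = real_of_int z * fact (nat (z - 1))"
    using True by (simp only: fact_Suc) (simp add: of_nat_Suc)
  then show ?thesis using True by (simp add: inv_fact_def)
qed (simp add: inv_fact_def)

lemma inv_fact_nonneg: "0 \<le> inv_fact z"
  by (simp add: inv_fact_def)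

text \<open>
The coefficient of \<open>t\<^sup>N\<close> in \<open>I\<^sub>k(2t)\<close>, extended by zero to the powers that do not occur. Times
\<open>N!\<close> it counts the walks of length \<open>N\<close> from \<open>0\<close> to \<open>k\<close> in \<open>\<int>\<close>.
\<close>

definition bessel_coeff :: "int \<Rightarrow> nat \<Rightarrow> real" where
  "bessel_coeff k N =
     (if even (int N + k) then inv_fact ((int N + k) div 2) * inv_fact ((int N - k) div 2) else 0)"

lemma bessel_coeff_nonneg: "0 \<le> bessel_coeff k N"
  by (simp add: bessel_coeff_def inv_fact_nonneg)

lemma bessel_coeff_minus: "bessel_coeff (- k) N = bessel_coeff k N"
  by (simp add: bessel_coeff_def mult.commute)

lemma bessel_coeff_0: "bessel_coeff k 0 = (if k = 0 then 1 else 0)"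
  by (auto simp: bessel_coeff_def inv_fact_def elim!: evenE)

text \<open>
This is Pascal's rule. With \<open>p + q = N + 1\<close> and \<open>p - q = k\<close>, it is the identity
\<open>(p + q)/(p! q!) = 1/((p-1)! q!) + 1/(p! (q-1)!)\<close>.
\<close>

lemma bessel_coeff_Suc:
  "real (Suc N) * bessel_coeff k (Suc N) = bessel_coeff (k - 1) N + bessel_coeff (k + 1) N"
proof (cases "even (int (Suc N) + k)")
  case True
  then obtain p where p: "int (Suc N) + k = 2 * p" by (elim evenE)
  define q where "q = int (Suc N) - p"
  have k: "k = p - q" and N: "int N = p + q - 1" using p by (auto simp: q_def)
  have 1: "int (Suc N) + k = 2 * p" "int (Suc N) - k = 2 * q"
    "int N + (k - 1) = 2 * (p - 1)" "int N - (k - 1) = 2 * q"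
    "int N + (k + 1) = 2 * p" "int N - (k + 1) = 2 * (q - 1)"
    unfolding k using N by (auto simp: algebra_simps)
  have "real (Suc N) = of_int p + of_int q"
    using arg_cong[OF N, of real_of_int] by simp
  then have "real (Suc N) * (inv_fact p * inv_fact q)
      = (of_int p * inv_fact p) * inv_fact q + inv_fact p * (of_int q * inv_fact q)"
    by (simp add: algebra_simps)
  then show ?thesis
    unfolding bessel_coeff_def 1 by (simp add: inv_fact_recursion)
next
  case False
  then have "odd (int N + (k - 1))" "odd (int N + (k + 1))" by auto
  with False show ?thesis by (simp add: bessel_coeff_def)
qed

text \<open>
There are \<open>2\<^sup>N\<close> walks of length \<open>N\<close>, whatever their endpoint.
\<close>

lemma has_sum_bessel_coeff: "((\<lambda>k. bessel_coeff k N) has_sum 2 ^ N / fact N) UNIV"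
proof (induction N)
  case 0
  have "((\<lambda>k::int. if k = 0 then 1 else 0::real) has_sum 1) {0}"
    by (rule has_sum_finiteI) auto
  then have "((\<lambda>k::int. if k = 0 then 1 else 0::real) has_sum 1) UNIV"
    by (rule has_sum_cong_neutral[THEN iffD1, rotated -1]) auto
  then show ?case by (simp add: bessel_coeff_0)
next
  case (Suc N)
  have shift: "((\<lambda>k. bessel_coeff (k + c) N) has_sum 2 ^ N / fact N) UNIV" for c
    by (rule has_sum_reindex_bij_witness[THEN iffD1, OF _ _ _ _ _ refl Suc.IH,
          of "\<lambda>k. k + c" "\<lambda>k. k - c"]) auto
  have "((\<lambda>k. bessel_coeff (k + (-1)) N + bessel_coeff (k + 1) N)
      has_sum 2 ^ N / fact N + 2 ^ N / fact N) UNIV"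
    by (intro has_sum_add shift)
  then have "((\<lambda>k. inverse (real (Suc N)) * (real (Suc N) * bessel_coeff k (Suc N)))
      has_sum inverse (real (Suc N)) * (2 ^ N / fact N + 2 ^ N / fact N)) UNIV"
    by (intro has_sum_cmult_right) (simp add: bessel_coeff_Suc del: of_nat_Suc)
  moreover have "inverse (real (Suc N)) * (2 ^ N / fact N + 2 ^ N / fact N) = 2 ^ Suc N / fact (Suc N)"
    by (simp add: field_simps)
  moreover have "inverse (real (Suc N)) * (real (Suc N) * bessel_coeff k (Suc N)) = bessel_coeff k (Suc N)" for k
    by (simp add: field_simps del: of_nat_Suc)
  ultimately show ?case by (simp only:)
qed

lemma bessel_coeff_le: "bessel_coeff k N \<le> 2 ^ N / fact N"
proof -
  have "bessel_coeff k N \<le> (\<Sum>\<^sub>\<infinity>k. bessel_coeff k N)"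
    using finite_sum_le_infsum[of "\<lambda>k. bessel_coeff k N" UNIV "{k}"] has_sum_bessel_coeff[of N]
    by (auto simp: bessel_coeff_nonneg has_sum_imp_summable)
  then show ?thesis using has_sum_bessel_coeff[of N] by (simp add: infsumI)
qed

lemma summable_bessel_coeff: "summable (\<lambda>N. bessel_coeff k N * y ^ N)"
proof (rule summable_comparison_test')
  show "summable (\<lambda>N. (2 * \<bar>y\<bar>) ^ N /\<^sub>R fact N)" by (rule summable_exp_generic)
  show "norm (bessel_coeff k N * y ^ N) \<le> (2 * \<bar>y\<bar>) ^ N /\<^sub>R fact N" for N
    using mult_right_mono[OF bessel_coeff_le[of k N], of "\<bar>y\<bar> ^ N"]
    by (simp add: abs_mult bessel_coeff_nonneg power_abs power_mult_distrib field_simps)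
qed

lemma bessel_I_series: "bessel_I k (2 * t) = (\<Sum>N. bessel_coeff k N * t ^ N)"
proof -
  define a where "a = nat \<bar>k\<bar>"
  have a: "bessel_coeff k = bessel_coeff (int a)"
    by (rule ext, cases "k \<ge> 0") (auto simp: a_def bessel_coeff_minus)
  have "(2 * t / 2) ^ (2 * n + nat \<bar>k\<bar>) / (fact n * Gamma (real n + real (nat \<bar>k\<bar>) + 1))
      = bessel_coeff (int a) (2 * n + a) * t ^ (2 * n + a)" for n
  proof -
    have 1: "int (2 * n + a) + int a = 2 * int (n + a)" "int (2 * n + a) - int a = 2 * int n"
      by auto
    have "Gamma (real n + real a + 1) = fact (n + a)"
      using Gamma_fact[of "n + a", where 'a = real] by (simp add: add_ac)
    then show ?thesis
      unfolding bessel_coeff_def 1 by (simp add: a_def[symmetric] inv_fact_def field_simps nat_add_distrib)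
  qed
  then have "bessel_I k (2 * t) = (\<Sum>n. bessel_coeff (int a) (2 * n + a) * t ^ (2 * n + a))"
    by (simp add: bessel_I_def)
  also have "\<dots> = (\<Sum>N. bessel_coeff (int a) N * t ^ N)"
  proof (rule suminf_mono_reindex[of "\<lambda>n. 2 * n + a" "\<lambda>N. bessel_coeff (int a) N * t ^ N"])
    show "strict_mono (\<lambda>n. 2 * n + a)" by (rule strict_monoI) simp
    fix N assume N: "N \<notin> range (\<lambda>n. 2 * n + a)"
    have "bessel_coeff (int a) N = 0"
    proof (cases "even (int N + int a) \<and> N \<ge> a")
      case True
      then have "even (N - a)" by auto
      then obtain n where "N - a = 2 * n" by (elim evenE)
      with True N show ?thesis by (metis (no_types, lifting) le_add_diff_inverse2 rangeI)
    next
      case False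
      then show ?thesis by (auto simp: bessel_coeff_def inv_fact_def)
    qed
    then show "bessel_coeff (int a) N * t ^ N = 0" by simp
  qed
  finally show ?thesis by (simp add: a)
qed

lemma bessel_I_derivative:
  "((\<lambda>t. bessel_I k (2 * t)) has_real_derivative
      bessel_I (k - 1) (2 * t) + bessel_I (k + 1) (2 * t)) (at t)"
proof -
  have "diffs (bessel_coeff k) N = bessel_coeff (k - 1) N + bessel_coeff (k + 1) N" for N
    unfolding diffs_def bessel_coeff_Suc[symmetric] by simp
  then have "(\<Sum>N. diffs (bessel_coeff k) N * t ^ N)
      = (\<Sum>N. bessel_coeff (k - 1) N * t ^ N + bessel_coeff (k + 1) N * t ^ N)"
    by (simp add: algebra_simps)
  also have "\<dots> = bessel_I (k - 1) (2 * t) + bessel_I (k + 1) (2 * t)"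
    unfolding bessel_I_series by (intro suminf_add[symmetric] summable_bessel_coeff)
  finally show ?thesis
    unfolding bessel_I_series[of k]
    using termdiffs_strong_converges_everywhere[of "bessel_coeff k" t, OF summable_bessel_coeff] by simp
qed

lemma bessel_I_nonneg: "0 \<le> t \<Longrightarrow> 0 \<le> bessel_I k (2 * t)"
  unfolding bessel_I_series by (intro suminf_nonneg summable_bessel_coeff) (simp add: bessel_coeff_nonneg)

lemma bessel_I_0_arg: "bessel_I k 0 = (if k = 0 then 1 else 0)"
proof -
  have "bessel_I k (2 * 0) = bessel_coeff k 0" unfolding bessel_I_series by (rule powser_zero)
  then show ?thesis by (simp add: bessel_coeff_0)
qed

lemma bessel_I_0_ge_1: 
  assumes "0 \<le> t" shows "1 \<le> bessel_I 0 (2 * t)"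
proof -
  have "sum (\<lambda>N. bessel_coeff 0 N * t ^ N) {..<1} \<le> bessel_I 0 (2 * t)"
    unfolding bessel_I_series using assms
    by (intro sum_le_suminf summable_bessel_coeff) (auto simp: bessel_coeff_nonneg)
  then show ?thesis by (simp add: bessel_coeff_0)
qed

text \<open>
The generating function \<open>\<Sum>\<^sub>k I\<^sub>k(x) z\<^sup>k = exp (x (z + 1/z) / 2)\<close> at \<open>z = 1\<close>. In terms of the heat
kernel it is conservation of mass in one dimension.
\<close>

lemma has_sum_bessel_I:
  assumes "0 \<le> t"
  shows "((\<lambda>k. bessel_I k (2 * t)) has_sum exp (2 * t)) UNIV"
proof -
  let ?f = "\<lambda>N k. bessel_coeff k N * t ^ N"
  have row: "((\<lambda>k. ?f N k) has_sum (2 * t) ^ N / fact N) UNIV" for N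
    using has_sum_cmult_left[OF has_sum_bessel_coeff[of N], of "t ^ N"] 
    by (simp add: power_mult_distrib)
  have exp: "((\<lambda>N. (2 * t) ^ N / fact N) has_sum exp (2 * t)) UNIV"
    using exp_converges[of "2 * t"] assms 
    by (intro sums_nonneg_imp_has_sum) (auto simp: divide_inverse_commute scaleR_conv_of_real)
  have "(\<lambda>(N, k). ?f N k) summable_on (SIGMA N:UNIV. UNIV)"
    using row has_sum_imp_summable[OF exp] assms
    by (intro summable_on_SigmaI[where g = "\<lambda>N. (2 * t) ^ N / fact N"])
       (auto simp: bessel_coeff_nonneg)
  then have "((\<lambda>(N, k). ?f N k) has_sum exp (2 * t)) (UNIV \<times> UNIV)"
    using row exp by (intro has_sum_SigmaI[where g = "\<lambda>N. (2 * t) ^ N / fact N"]) auto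
  then have *: "((\<lambda>(k, N). ?f N k) has_sum exp (2 * t)) (UNIV \<times> UNIV)"
    by (subst (asm) has_sum_swap) (simp add: case_prod_unfold)
  have col: "((\<lambda>N. ?f N k) has_sum bessel_I k (2 * t)) UNIV" for k
    unfolding bessel_I_series using assms summable_sums[OF summable_bessel_coeff[of k t]]
    by (intro sums_nonneg_imp_has_sum) (auto simp: bessel_coeff_nonneg)
  show ?thesis
    using has_sum_SigmaD[OF *, of "\<lambda>k. bessel_I k (2 * t)"] col by simp
qed

section \<open>The heat kernel, its resolvent and the fractional kernel\<close>

definition heat_kernel :: "real \<Rightarrow> int ^ 'd \<Rightarrow> real" where
  "heat_kernel t m = exp (- 2 * real CARD('d) * t) * (\<Prod>i\<in>UNIV. bessel_I (m $ i) (2 * t))"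

lemma heat_kernel_nonneg: "0 \<le> t \<Longrightarrow> 0 \<le> heat_kernel t m"
  unfolding heat_kernel_def by (intro mult_nonneg_nonneg prod_nonneg) (auto intro: bessel_I_nonneg)

lemma heat_kernel_0: "heat_kernel 0 m = (if m = 0 then 1 else 0)"
  by (auto simp: heat_kernel_def bessel_I_0_arg vec_eq_iff intro!: prod.neutral)

text \<open>
Since \<open>d/dt I\<^sub>k(2t) = I\<^bsub>k-1\<^esub>(2t) + I\<^bsub>k+1\<^esub>(2t)\<close>, differentiating one factor of the product moves
the corresponding coordinate to its two neighbours.
\<close>

lemma heat_equation:
  fixes m :: "int ^ 'd"
  shows "((\<lambda>t. heat_kernel t m) has_real_derivative
     (\<Sum>i\<in>UNIV. heat_kernel t (m + axis i 1) + heat_kernel t (m - axis i 1))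
       - 2 * real CARD('d) * heat_kernel t m) (at t)"
proof -
  let ?c = "2 * real CARD('d)"
  let ?rest = "\<lambda>i. \<Prod>j\<in>UNIV - {i}. bessel_I (m $ j) (2 * t)"
  have nb: "(\<Prod>j\<in>UNIV. bessel_I ((m + axis i c) $ j) (2 * t)) = bessel_I (m $ i + c) (2 * t) * ?rest i"
    for i c
    by (subst prod.remove[of UNIV i]) (auto simp: axis_def intro!: prod.cong)
  have nb': "(\<Prod>j\<in>UNIV. bessel_I ((m - axis i 1) $ j) (2 * t)) = bessel_I (m $ i - 1) (2 * t) * ?rest i"
    for i
    by (subst prod.remove[of UNIV i]) (auto simp: axis_def intro!: prod.cong)
  have hk: "heat_kernel t n = exp (- ?c * t) * (\<Prod>i\<in>UNIV. bessel_I (n $ i) (2 * t))" for t and n :: "int ^ 'd"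
    by (simp add: heat_kernel_def)
  have "((\<lambda>t. heat_kernel t m) has_real_derivative
      exp (- ?c * t) * (- ?c) * (\<Prod>i\<in>UNIV. bessel_I (m $ i) (2 * t))
      + (\<Sum>i\<in>UNIV. (bessel_I (m $ i - 1) (2 * t) + bessel_I (m $ i + 1) (2 * t)) * ?rest i) * exp (- ?c * t))
      (at t)"
    unfolding hk by (intro DERIV_mult has_field_derivative_prod bessel_I_derivative)
       (auto intro!: derivative_eq_intros)
  moreover have "exp (- ?c * t) * (- ?c) * (\<Prod>i\<in>UNIV. bessel_I (m $ i) (2 * t))
      + (\<Sum>i\<in>UNIV. (bessel_I (m $ i - 1) (2 * t) + bessel_I (m $ i + 1) (2 * t)) * ?rest i) * exp (- ?c * t)
      = (\<Sum>i\<in>UNIV. heat_kernel t (m + axis i 1) + heat_kernel t (m - axis i 1)) - ?c * heat_kernel t m"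
    unfolding hk nb nb' by (simp add: sum_distrib_left sum_distrib_right algebra_simps)
  ultimately show ?thesis by (rule DERIV_cong)
qed

lemma continuous_heat_kernel: "continuous_on S (\<lambda>t. heat_kernel t m)"
  by (intro continuous_at_imp_continuous_on ballI DERIV_isCont[OF heat_equation])

lemma measurable_heat_kernel [measurable]: "(\<lambda>t. heat_kernel t m) \<in> borel_measurable borel"
  by (intro borel_measurable_continuous_onI continuous_heat_kernel)

text \<open>
Enlarging \<open>F\<close> to a product of finite sets factorises the sum into one-dimensional ones, each at
most \<open>e\<^bsup>2t\<^esup>\<close>. The bound for finite sums already gives the summability of every kernel below.
\<close>

lemma sum_heat_kernel_le_1:
  fixes F :: "(int ^ 'd) set"
  assumes "finite F" "0 \<le> t"
  shows "(\<Sum>m\<in>F. heat_kernel t m) \<le> 1"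
proof -
  define S where "S = (\<Union>m\<in>F. range (($) m))"
  have S: "finite S" unfolding S_def using assms by auto
  let ?b = "\<lambda>k. bessel_I k (2 * t)"
  have "(\<Sum>m\<in>F. \<Prod>i\<in>UNIV. ?b (m $ i)) = (\<Sum>g\<in>vec_nth ` F. \<Prod>i\<in>UNIV. ?b (g i))"
    by (subst sum.reindex) (auto simp: inj_on_def vec_nth_inject)
  also have "\<dots> \<le> (\<Sum>g\<in>PiE (UNIV :: 'd set) (\<lambda>_. S). \<Prod>i\<in>UNIV. ?b (g i))"
  proof (rule sum_mono2)
    show "vec_nth ` F \<subseteq> PiE (UNIV :: 'd set) (\<lambda>_. S)" by (auto simp: S_def)
  qed (auto intro!: prod_nonneg finite_PiE bessel_I_nonneg simp: S assms)
  also have "\<dots> = (\<Prod>i\<in>(UNIV :: 'd set). \<Sum>k\<in>S. ?b k)"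
    by (rule prod_sum_PiE[symmetric]) (auto simp: S)
  also have "\<dots> \<le> (\<Prod>i\<in>(UNIV :: 'd set). exp (2 * t))"
  proof (intro prod_mono conjI)
    show "(\<Sum>k\<in>S. ?b k) \<le> exp (2 * t)"
      using finite_sum_le_infsum[of ?b UNIV S] has_sum_bessel_I[OF assms(2)] S assms(2)
      by (auto simp: bessel_I_nonneg has_sum_imp_summable infsumI)
  qed (auto intro!: sum_nonneg bessel_I_nonneg assms)
  also have "\<dots> = exp (2 * real CARD('d) * t)"
    by (simp add: exp_of_nat_mult[symmetric] mult_ac)
  finally have "exp (- 2 * real CARD('d) * t) * (\<Sum>m\<in>F. \<Prod>i\<in>UNIV. ?b (m $ i))
      \<le> exp (- 2 * real CARD('d) * t) * exp (2 * real CARD('d) * t)"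
    by (intro mult_left_mono) auto
  then show ?thesis by (simp add: heat_kernel_def sum_distrib_left exp_add[symmetric])
qed

lemma heat_kernel_le_1: "0 \<le> t \<Longrightarrow> heat_kernel t m \<le> 1"
  using sum_heat_kernel_le_1[of "{m}" t] by simp

text \<open>
The heat that has left the origin by time \<open>t\<close> is \<open>O(t)\<close>, which makes the singularity
\<open>t\<^bsup>-1-s\<^esup>\<close> integrable at \<open>0\<close> in the fractional kernel.
\<close>

lemma heat_kernel_origin_ge:
  assumes "0 \<le> t"
  shows "1 - 2 * real CARD('d) * t \<le> heat_kernel t (0 :: int ^ 'd)"
proof -
  have "1 - 2 * real CARD('d) * t \<le> exp (- 2 * real CARD('d) * t)"
    using exp_ge_add_one_self[of "- 2 * real CARD('d) * t"] by simp
  also have "\<dots> \<le> heat_kernel t (0 :: int ^ 'd)"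
    using bessel_I_0_ge_1[OF assms] by (simp add: heat_kernel_def)
  finally show ?thesis .
qed

lemma set_integral_via_has_integral:
  fixes f :: "real \<Rightarrow> real"
  assumes "(f has_integral I) S" "\<And>x. x \<in> S \<Longrightarrow> 0 \<le> f x"
    and "(\<lambda>x. indicator S x * f x) \<in> borel_measurable borel"
  shows "set_integrable lborel S f" "(LINT x:S|lborel. f x) = I"
proof -
  have "0 \<le> I" using assms(1,2) by (rule has_integral_nonneg)
  have "(\<integral>\<^sup>+x. ennreal (indicator S x * f x) \<partial>lborel) = ennreal I"
    using assms by (intro nn_integral_has_integral_lebesgue)
  then have "has_bochner_integral lborel (\<lambda>x. indicator S x * f x) I"
    using assms \<open>0 \<le> I\<close> by (intro has_bochner_integral_nn_integral) (auto simp: indicator_def)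
  then show "set_integrable lborel S f" "(LINT x:S|lborel. f x) = I"
    by (auto simp: set_integrable_def set_lebesgue_integral_def has_bochner_integral_iff)
qed

lemma exp_integral:
  assumes "(0::real) < \<mu>"
  shows "set_integrable lborel {0<..} (\<lambda>t. exp (- \<mu> * t))"
    and "(LINT t:{0<..}|lborel. exp (- \<mu> * t)) = 1 / \<mu>"
proof -
  have "((\<lambda>t. exp (- \<mu> * t)) has_integral 1 / \<mu>) {0..}"
    using has_integral_exp_minus_to_infinity[OF assms, of 0] by simp
  then have "((\<lambda>t. exp (- \<mu> * t)) has_integral 1 / \<mu>) {0<..}"
    by (rule has_integral_spike_set_eq[THEN iffD1, rotated 2])
       (auto intro!: negligible_subset[OF negligible_sing[of 0]])
  from set_integral_via_has_integral[OF this]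
  show "set_integrable lborel {0<..} (\<lambda>t. exp (- \<mu> * t))"
    and "(LINT t:{0<..}|lborel. exp (- \<mu> * t)) = 1 / \<mu>"
    by auto
qed

lemma set_integral_finite_sum:
  fixes f :: "'i \<Rightarrow> 'a \<Rightarrow> 'b :: {banach, second_countable_topology}"
  assumes "\<And>i. i \<in> I \<Longrightarrow> set_integrable M A (f i)"
  shows "set_integrable M A (\<lambda>x. \<Sum>i\<in>I. f i x)"
    and "(LINT x:A|M. (\<Sum>i\<in>I. f i x)) = (\<Sum>i\<in>I. LINT x:A|M. f i x)"
  using assms unfolding set_integrable_def set_lebesgue_integral_def scaleR_sum_right
  by (auto intro!: Bochner_Integration.integrable_sum Bochner_Integration.integral_sum)

definition resolvent_kernel :: "real \<Rightarrow> int ^ 'd \<Rightarrow> real" where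
  "resolvent_kernel \<mu> m = (LINT t:{0<..}|lborel. exp (- \<mu> * t) * heat_kernel t m)"

lemma resolvent_integrable:
  assumes "0 < \<mu>"
  shows "set_integrable lborel {0<..} (\<lambda>t. exp (- \<mu> * t) * heat_kernel t m)"
proof (rule set_integrable_bound[OF exp_integral(1)[OF assms]])
  show "AE t in lborel. t \<in> {0<..} \<longrightarrow> norm (exp (- \<mu> * t) * heat_kernel t m) \<le> norm (exp (- \<mu> * t))"
    by (auto simp: abs_mult heat_kernel_nonneg heat_kernel_le_1)
qed (auto simp: set_borel_measurable_def)

lemma resolvent_kernel_nonneg: "0 \<le> resolvent_kernel \<mu> m"
  unfolding resolvent_kernel_def
  unfolding set_lebesgue_integral_def
  by (intro Bochner_Integration.integral_nonneg) (auto simp: heat_kernel_nonneg indicator_def)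

lemma sum_resolvent_kernel_le:
  assumes "0 < \<mu>" "finite F"
  shows "(\<Sum>m\<in>F. resolvent_kernel \<mu> m) \<le> 1 / \<mu>"
proof -
  have "(\<Sum>m\<in>F. resolvent_kernel \<mu> m) = (LINT t:{0<..}|lborel. (\<Sum>m\<in>F. exp (- \<mu> * t) * heat_kernel t m))"
    unfolding resolvent_kernel_def
    by (rule set_integral_finite_sum(2)[symmetric]) (rule resolvent_integrable[OF assms(1)])
  also have "\<dots> \<le> (LINT t:{0<..}|lborel. exp (- \<mu> * t))"
    using assms
    by (intro set_integral_mono set_integral_finite_sum resolvent_integrable exp_integral)
       (auto simp: sum_distrib_left[symmetric] sum_heat_kernel_le_1)
  finally show ?thesis using exp_integral(2)[OF assms(1)] by simp
qed

lemma summable_resolvent_kernel: "0 < \<mu> \<Longrightarrow> resolvent_kernel \<mu> summable_on UNIV"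
  by (rule nonneg_bdd_above_summable_on)
     (auto simp: resolvent_kernel_nonneg intro!: bdd_aboveI2 sum_resolvent_kernel_le)

text \<open>
Integrate \<open>d/dt (e\<^bsup>-\<mu>t\<^esup> P\<^sub>t) = - e\<^bsup>-\<mu>t\<^esup> (\<mu> - \<Delta>) P\<^sub>t\<close> over \<open>(0, \<infinity>)\<close>. The boundary term at \<open>0\<close> is
the point mass \<open>P\<^sub>0\<close>.
\<close>

lemma resolvent_equation:
  fixes m :: "int ^ 'd"
  assumes "0 < \<mu>"
  shows "(\<mu> + 2 * real CARD('d)) * resolvent_kernel \<mu> m
     - (\<Sum>i\<in>UNIV. resolvent_kernel \<mu> (m + axis i 1) + resolvent_kernel \<mu> (m - axis i 1))
     = (if m = 0 then 1 else 0)"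
proof -
  let ?c = "2 * real CARD('d)"
  let ?g = "\<lambda>m t. exp (- \<mu> * t) * heat_kernel t m"
  let ?D = "\<lambda>t. (\<Sum>i\<in>UNIV. ?g (m + axis i 1) t + ?g (m - axis i 1) t) - (\<mu> + ?c) * ?g m t"
  have int: "set_integrable lborel {0<..} (?g n)" for n :: "int ^ 'd"
    using assms by (rule resolvent_integrable)
  have intD: "set_integrable lborel {0<..} ?D"
    by (intro set_integral_diff set_integral_finite_sum(1) set_integral_add set_integrable_mult_right int)
  have deriv: "(?g m has_vector_derivative ?D t) (at t)" for t
    unfolding has_real_derivative_iff_has_vector_derivative[symmetric]
    by (rule derivative_eq_intros heat_equation refl | simp add: sum_distrib_left sum_distrib_right algebra_simps)+
  have contD: "isCont ?D t" for t
    using continuous_heat_kernel[of UNIV] by (intro continuous_intros) (auto simp: continuous_on_eq_continuous_at)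
  have "(LBINT t=0..\<infinity>. ?D t) = 0 - heat_kernel 0 m"
  proof (rule interval_integral_FTC_integrable)
    show "set_integrable lborel (einterval 0 \<infinity>) ?D" using intD by (simp add: zero_ereal_def)
    have "isCont (?g m) 0"
      using continuous_heat_kernel[of UNIV m] by (intro continuous_intros) (auto simp: continuous_on_eq_continuous_at)
    then have "(?g m \<longlongrightarrow> heat_kernel 0 m) (at_right 0)"
      by (simp add: isCont_def filterlim_at_split)
    then show "((?g m \<circ> real_of_ereal) \<longlongrightarrow> heat_kernel 0 m) (at_right 0)"
      by (simp add: zero_ereal_def ereal_tendsto_simps)
    have "(?g m \<longlongrightarrow> 0) at_top"
    proof (rule Lim_null_comparison)
      show "\<forall>\<^sub>F t in at_top. norm (?g m t) \<le> exp (- \<mu> * t)"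
        using eventually_ge_at_top[of 0]
        by eventually_elim (auto simp: abs_mult heat_kernel_nonneg heat_kernel_le_1)
      have "LIM t at_top. - \<mu> * t :> at_bot"
        using assms by (intro filterlim_tendsto_neg_mult_at_bot[OF tendsto_const]) (auto simp: filterlim_ident)
      then show "((\<lambda>t. exp (- \<mu> * t)) \<longlongrightarrow> 0) at_top"
        by (rule filterlim_compose[OF exp_at_bot])
    qed
    then show "((?g m \<circ> real_of_ereal) \<longlongrightarrow> 0) (at_left \<infinity>)"
      by (simp add: ereal_tendsto_simps)
  qed (use deriv contD in auto)
  moreover have "(LBINT t=0..\<infinity>. ?D t) = (LINT t:{0<..}|lborel. ?D t)"
    by (simp add: interval_lebesgue_integral_def zero_ereal_def)
  moreover have "(LINT t:{0<..}|lborel. ?D t)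
      = (\<Sum>i\<in>UNIV. resolvent_kernel \<mu> (m + axis i 1) + resolvent_kernel \<mu> (m - axis i 1))
        - (\<mu> + ?c) * resolvent_kernel \<mu> m"
  proof -
    have sum: "set_integrable lborel {0<..} (\<lambda>t. \<Sum>i\<in>UNIV. ?g (m + axis i 1) t + ?g (m - axis i 1) t)"
      by (intro set_integral_finite_sum(1) set_integral_add int)
    have "(LINT t:{0<..}|lborel. ?D t)
       = (LINT t:{0<..}|lborel. \<Sum>i\<in>UNIV. ?g (m + axis i 1) t + ?g (m - axis i 1) t)
         - (LINT t:{0<..}|lborel. (\<mu> + ?c) * ?g m t)"
      by (rule set_integral_diff(2)) (intro sum set_integrable_mult_right int)+
    also have "(LINT t:{0<..}|lborel. \<Sum>i\<in>UNIV. ?g (m + axis i 1) t + ?g (m - axis i 1) t)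
       = (\<Sum>i\<in>UNIV. LINT t:{0<..}|lborel. ?g (m + axis i 1) t + ?g (m - axis i 1) t)"
      by (rule set_integral_finite_sum(2)) (intro set_integral_add int)
    finally show ?thesis
      unfolding set_integral_add(2)[OF int int] set_integral_mult_right resolvent_kernel_def .
  qed
  ultimately show ?thesis by (simp add: heat_kernel_0 split: if_splits)
qed

lemma heat_kernel_le_origin:
  fixes F :: "(int ^ 'd) set"
  assumes "0 \<le> t" "finite F" "0 \<notin> F"
  shows "(\<Sum>m\<in>F. heat_kernel t m) \<le> 1 - heat_kernel t (0 :: int ^ 'd)"
  using sum_heat_kernel_le_1[of "insert 0 F" t] assms by simp

text \<open>
The integrand is at most \<open>2d t\<^bsup>-s\<^esup>\<close>, which is integrable near \<open>0\<close> because \<open>s < 1\<close>, and at most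
\<open>t\<^bsup>-1-s\<^esup>\<close>, which is integrable near \<open>\<infinity>\<close> because \<open>s > 0\<close>. As \<open>1 - P\<^sub>t(0)\<close> bounds the heat at all
other sites together, it controls the \<open>\<ell>\<^sup>1\<close> norm of the fractional kernel.
\<close>

lemma escape_integrable:
  assumes "0 < s" "s < 1"
  shows "set_integrable lborel {0<..} (\<lambda>t. (1 - heat_kernel t (0 :: int ^ 'd)) / t powr (1 + s))"
proof -
  let ?f = "\<lambda>t. (1 - heat_kernel t (0 :: int ^ 'd)) / t powr (1 + s)"
  have f_nonneg: "0 \<le> ?f t" if "0 < t" for t
    using heat_kernel_le_1[of t "0 :: int ^ 'd"] that by simp
  have "set_integrable lborel {0..1} (\<lambda>t. t powr (- s))"
    using has_integral_powr_from_0[of "- s" 1] assms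
    by (intro set_integral_via_has_integral(1)) auto
  then have "set_integrable lborel {0<..1} (\<lambda>t. t powr (- s))"
    by (rule set_integrable_subset) auto
  then have "set_integrable lborel {0<..1} (\<lambda>t. 2 * real CARD('d) * t powr (- s))"
    by (rule set_integrable_mult_right)
  then have near: "set_integrable lborel {0<..1} ?f"
  proof (rule set_integrable_bound)
    show "AE t in lborel. t \<in> {0<..1} \<longrightarrow> norm (?f t) \<le> norm (2 * real CARD('d) * t powr (- s))"
    proof (intro AE_I2 impI)
      fix t :: real assume t: "t \<in> {0<..1}"
      then have "1 - heat_kernel t (0 :: int ^ 'd) \<le> 2 * real CARD('d) * t"
        using heat_kernel_origin_ge[of t, where 'd = 'd] by simp
      then have "?f t \<le> 2 * real CARD('d) * t / t powr (1 + s)"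
        by (intro divide_right_mono) auto
      also have "\<dots> = 2 * real CARD('d) * t powr (- s)"
        using t by (simp add: powr_add powr_minus field_simps)
      finally show "norm (?f t) \<le> norm (2 * real CARD('d) * t powr (- s))"
        using f_nonneg[of t] t by auto
    qed
  qed (auto simp: set_borel_measurable_def)
  have "set_integrable lborel {1..} (\<lambda>t. t powr (- 1 - s))"
    using has_integral_powr_to_inf[of "- 1 - s" 1] assms
    by (intro set_integral_via_has_integral(1)) auto
  then have far: "set_integrable lborel {1..} ?f"
  proof (rule set_integrable_bound)
    show "AE t in lborel. t \<in> {1..} \<longrightarrow> norm (?f t) \<le> norm (t powr (- 1 - s))"
    proof (intro AE_I2 impI)
      fix t :: real assume t: "t \<in> {1..}"
      then have "?f t \<le> 1 / t powr (1 + s)"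
        using heat_kernel_nonneg[of t "0 :: int ^ 'd"] by (intro divide_right_mono) auto
      also have "\<dots> = t powr (- 1 - s)"
        using powr_minus[of t "1 + s"] by (simp add: inverse_eq_divide)
      finally show "norm (?f t) \<le> norm (t powr (- 1 - s))"
        using f_nonneg[of t] t by auto
    qed
  qed (auto simp: set_borel_measurable_def)
  have "{0<..} = {0<..1} \<union> {1::real..}" by auto
  then show ?thesis using set_integrable_Un[OF near far] by simp
qed

lemma levy_integrable:
  fixes m :: "int ^ 'd"
  assumes "0 < s" "s < 1" "m \<noteq> 0"
  shows "set_integrable lborel {0<..} (\<lambda>t. heat_kernel t m / t powr (1 + s))"
proof (rule set_integrable_bound[OF escape_integrable[where 'd = 'd, OF assms(1,2)]])
  show "AE t in lborel. t \<in> {0<..} \<longrightarrow> norm (heat_kernel t m / t powr (1 + s))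
      \<le> norm ((1 - heat_kernel t (0 :: int ^ 'd)) / t powr (1 + s))"
  proof (intro AE_I2 impI)
    fix t :: real assume t: "t \<in> {0<..}"
    then show "norm (heat_kernel t m / t powr (1 + s))
      \<le> norm ((1 - heat_kernel t (0 :: int ^ 'd)) / t powr (1 + s))"
      using heat_kernel_le_origin[of t "{m}"] heat_kernel_nonneg[of t m] assms(3)
      by (auto simp: abs_mult intro!: divide_right_mono)
  qed
qed (auto simp: set_borel_measurable_def)

lemma frac_kernel_eq_heat:
  fixes m :: "int ^ 'd"
  assumes "m \<noteq> 0"
  shows "frac_kernel h s m = 1 / (h powr (2 * s) * \<bar>Gamma (- s)\<bar>)
     * (LINT t:{0<..}|lborel. heat_kernel t m / t powr (1 + s))"
  using assms by (simp add: frac_kernel_def heat_kernel_def)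

lemma frac_kernel_nonneg: "0 \<le> frac_kernel h s (m :: int ^ 'd)"
proof (cases "m = 0")
  case False
  have "0 \<le> (LINT t:{0<..}|lborel. heat_kernel t m / t powr (1 + s))"
    unfolding set_lebesgue_integral_def
    by (intro Bochner_Integration.integral_nonneg) (auto simp: heat_kernel_nonneg indicator_def)
  then show ?thesis unfolding frac_kernel_eq_heat[OF False] by (intro mult_nonneg_nonneg) auto
qed (simp add: frac_kernel_def)

lemma summable_frac_kernel:
  assumes "0 < s" "s < 1"
  shows "(frac_kernel h s :: int ^ 'd \<Rightarrow> real) summable_on UNIV"
proof (rule nonneg_bdd_above_summable_on)
  let ?C = "1 / (h powr (2 * s) * \<bar>Gamma (- s)\<bar>)"
  show "bdd_above (sum (frac_kernel h s :: int ^ 'd \<Rightarrow> real) ` {F. F \<subseteq> UNIV \<and> finite F})"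
  proof (rule bdd_aboveI2)
    fix F :: "(int ^ 'd) set" assume "F \<in> {F. F \<subseteq> UNIV \<and> finite F}"
    then have F: "finite F" by simp
    have "sum (frac_kernel h s) F = sum (frac_kernel h s) (F - {0})"
      using F by (intro sum.mono_neutral_right) (auto simp: frac_kernel_def)
    also have "\<dots> = ?C * (\<Sum>m\<in>F - {0}. LINT t:{0<..}|lborel. heat_kernel t m / t powr (1 + s))"
      unfolding sum_distrib_left by (intro sum.cong refl frac_kernel_eq_heat) auto
    also have "(\<Sum>m\<in>F - {0}. LINT t:{0<..}|lborel. heat_kernel t m / t powr (1 + s))
        = (LINT t:{0<..}|lborel. (\<Sum>m\<in>F - {0}. heat_kernel t m / t powr (1 + s)))"
      by (rule set_integral_finite_sum(2)[symmetric]) (auto intro!: levy_integrable assms)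
    also have "\<dots> \<le> (LINT t:{0<..}|lborel. (1 - heat_kernel t (0 :: int ^ 'd)) / t powr (1 + s))"
      using F by (intro set_integral_mono set_integral_finite_sum levy_integrable escape_integrable assms)
         (auto simp: sum_divide_distrib[symmetric] intro!: divide_right_mono heat_kernel_le_origin)
    finally show "sum (frac_kernel h s) F
        \<le> ?C * (LINT t:{0<..}|lborel. (1 - heat_kernel t (0 :: int ^ 'd)) / t powr (1 + s))"
      by (simp add: mult_left_mono divide_right_mono)
  qed
qed (rule frac_kernel_nonneg)

text \<open>
Euler's integral for \<open>\<Gamma>(1+s)\<close> after the substitution \<open>x = t\<mu>\<close>.
\<close>

lemma Gamma_scaled_nn_integral:
  fixes s t :: real
  assumes "0 < s" "0 < t"
  shows "(\<integral>\<^sup>+\<mu>. ennreal (indicator {0<..} \<mu> * (\<mu> powr s * exp (- \<mu> * t))) \<partial>lborel)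
    = ennreal (Gamma (1 + s) / t powr (1 + s))"
proof -
  let ?I = "\<integral>\<^sup>+\<mu>. ennreal (indicator {0<..} \<mu> * (\<mu> powr s * exp (- \<mu> * t))) \<partial>lborel"
  have "ennreal (Gamma (1 + s)) = (\<integral>\<^sup>+x. ennreal (indicator {0..} x * x powr s / exp x) \<partial>lborel)"
    using Gamma_conv_nn_integral_real[of "1 + s"] assms by simp
  also have "\<dots> = ennreal t * (\<integral>\<^sup>+\<mu>. ennreal (indicator {0..} (0 + t * \<mu>) * (0 + t * \<mu>) powr s / exp (0 + t * \<mu>)) \<partial>lborel)"
    using assms by (subst nn_integral_real_affine[where c = t and t = 0]) auto
  also have "(\<integral>\<^sup>+\<mu>. ennreal (indicator {0..} (0 + t * \<mu>) * (0 + t * \<mu>) powr s / exp (0 + t * \<mu>)) \<partial>lborel)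
     = (\<integral>\<^sup>+\<mu>. ennreal (t powr s) * ennreal (indicator {0<..} \<mu> * (\<mu> powr s * exp (- \<mu> * t))) \<partial>lborel)"
    using assms
    by (intro nn_integral_cong)
       (auto simp: indicator_def powr_mult exp_minus ennreal_mult[symmetric] zero_le_mult_iff mult_ac divide_inverse)
  also have "\<dots> = ennreal (t powr s) * ?I" by (rule nn_integral_cmult) measurable
  finally have "ennreal (Gamma (1 + s)) = ennreal (t powr (1 + s)) * ?I"
    using assms by (simp add: powr_add ennreal_mult mult.assoc)
  then have "ennreal (1 / t powr (1 + s)) * ennreal (Gamma (1 + s))
      = ennreal (1 / t powr (1 + s)) * ennreal (t powr (1 + s)) * ?I"
    by (simp add: mult.assoc)
  then show ?thesis using assms by (simp add: ennreal_mult[symmetric])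
qed

lemma measurable_resolvent_kernel [measurable]: "(\<lambda>\<mu>. resolvent_kernel \<mu> m) \<in> borel_measurable borel"
proof -
  have "(\<lambda>\<mu>. LINT t|lborel. indicator {0<..} t *\<^sub>R (exp (- \<mu> * t) * heat_kernel t m)) \<in> borel_measurable borel"
    by (intro lborel.borel_measurable_lebesgue_integral) measurable
  then show ?thesis by (simp add: resolvent_kernel_def set_lebesgue_integral_def)
qed

text \<open>
Tonelli's theorem for the integrand \<open>\<mu>\<^sup>s e\<^bsup>-\<mu>t\<^esup> P\<^sub>t(m)\<close>, integrated first over \<open>t\<close> on one side and
first over \<open>\<mu>\<close> on the other. At \<open>m = 0\<close> both sides would be infinite.
\<close>

lemma resolvent_subordination:
  fixes m :: "int ^ 'd"
  assumes "0 < s" "s < 1" "m \<noteq> 0"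
  shows "set_integrable lborel {0<..} (\<lambda>\<mu>. \<mu> powr s * resolvent_kernel \<mu> m)"
    and "(LINT \<mu>:{0<..}|lborel. \<mu> powr s * resolvent_kernel \<mu> m)
       = Gamma (1 + s) * (LINT t:{0<..}|lborel. heat_kernel t m / t powr (1 + s))"
proof -
  let ?H = "LINT t:{0<..}|lborel. heat_kernel t m / t powr (1 + s)"
  let ?i = "indicator {0<..} :: real \<Rightarrow> real"
  have H0: "0 \<le> ?H"
    unfolding set_lebesgue_integral_def
    by (intro Bochner_Integration.integral_nonneg) (auto simp: heat_kernel_nonneg indicator_def)
  have "(\<integral>\<^sup>+\<mu>. ennreal (?i \<mu> * (\<mu> powr s * resolvent_kernel \<mu> m)) \<partial>lborel)
      = (\<integral>\<^sup>+\<mu>. \<integral>\<^sup>+t. ennreal (?i t * heat_kernel t m) * ennreal (?i \<mu> * (\<mu> powr s * exp (- \<mu> * t))) \<partial>lborel \<partial>lborel)"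
  proof (intro nn_integral_cong)
    fix \<mu> :: real
    show "ennreal (?i \<mu> * (\<mu> powr s * resolvent_kernel \<mu> m))
      = (\<integral>\<^sup>+t. ennreal (?i t * heat_kernel t m) * ennreal (?i \<mu> * (\<mu> powr s * exp (- \<mu> * t))) \<partial>lborel)"
    proof (cases "0 < \<mu>")
      case True
      have "(\<integral>\<^sup>+t. ennreal (?i t * (exp (- \<mu> * t) * heat_kernel t m)) \<partial>lborel) = ennreal (resolvent_kernel \<mu> m)"
        using resolvent_integrable[OF True, of m]
        unfolding resolvent_kernel_def set_lebesgue_integral_def set_integrable_def
        by (subst nn_integral_eq_integral) (auto simp: heat_kernel_nonneg indicator_def)
      then have "ennreal (?i \<mu> * (\<mu> powr s * resolvent_kernel \<mu> m))
         = ennreal (\<mu> powr s) * (\<integral>\<^sup>+t. ennreal (?i t * (exp (- \<mu> * t) * heat_kernel t m)) \<partial>lborel)"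
        using True by (simp add: ennreal_mult resolvent_kernel_nonneg)
      also have "\<dots> = (\<integral>\<^sup>+t. ennreal (\<mu> powr s) * ennreal (?i t * (exp (- \<mu> * t) * heat_kernel t m)) \<partial>lborel)"
        by (rule nn_integral_cmult[symmetric]) measurable
      also have "\<dots> = (\<integral>\<^sup>+t. ennreal (?i t * heat_kernel t m) * ennreal (?i \<mu> * (\<mu> powr s * exp (- \<mu> * t))) \<partial>lborel)"
        using True
        by (intro nn_integral_cong) (auto simp: indicator_def heat_kernel_nonneg ennreal_mult[symmetric] mult_ac)
      finally show ?thesis .
    qed simp
  qed
  also have "\<dots> = (\<integral>\<^sup>+t. \<integral>\<^sup>+\<mu>. ennreal (?i t * heat_kernel t m) * ennreal (?i \<mu> * (\<mu> powr s * exp (- \<mu> * t))) \<partial>lborel \<partial>lborel)"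
    by (rule lborel_pair.Fubini') measurable
  also have "\<dots> = (\<integral>\<^sup>+t. ennreal (?i t * heat_kernel t m) * (\<integral>\<^sup>+\<mu>. ennreal (?i \<mu> * (\<mu> powr s * exp (- \<mu> * t))) \<partial>lborel) \<partial>lborel)"
    by (intro nn_integral_cong nn_integral_cmult) measurable
  also have "\<dots> = (\<integral>\<^sup>+t. ennreal (Gamma (1 + s) * (?i t *\<^sub>R (heat_kernel t m / t powr (1 + s)))) \<partial>lborel)"
  proof (intro nn_integral_cong)
    fix t :: real
    show "ennreal (?i t * heat_kernel t m) * (\<integral>\<^sup>+\<mu>. ennreal (?i \<mu> * (\<mu> powr s * exp (- \<mu> * t))) \<partial>lborel)
      = ennreal (Gamma (1 + s) * (?i t *\<^sub>R (heat_kernel t m / t powr (1 + s))))"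
      unfolding Gamma_scaled_nn_integral[OF assms(1)]
      using assms Gamma_scaled_nn_integral[OF assms(1), of t]
      by (cases "0 < t") (simp_all add: heat_kernel_nonneg ennreal_mult[symmetric] less_imp_le mult_ac)
  qed
  also have "\<dots> = ennreal (Gamma (1 + s) * ?H)"
    unfolding set_lebesgue_integral_def integral_mult_right_zero[symmetric]
    using integrable_mult_right[OF levy_integrable[OF assms, unfolded set_integrable_def], of "Gamma (1 + s)"] assms
    by (intro nn_integral_eq_integral)
       (auto simp: heat_kernel_nonneg indicator_def less_imp_le)
  finally have "has_bochner_integral lborel (\<lambda>\<mu>. ?i \<mu> * (\<mu> powr s * resolvent_kernel \<mu> m)) (Gamma (1 + s) * ?H)"
    using H0 assms by (intro has_bochner_integral_nn_integral) (auto simp: resolvent_kernel_nonneg indicator_def less_imp_le)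
  then show "set_integrable lborel {0<..} (\<lambda>\<mu>. \<mu> powr s * resolvent_kernel \<mu> m)"
    and "(LINT \<mu>:{0<..}|lborel. \<mu> powr s * resolvent_kernel \<mu> m) = Gamma (1 + s) * ?H"
    by (auto simp: set_integrable_def set_lebesgue_integral_def has_bochner_integral_iff)
qed

lemma frac_kernel_subordination:
  fixes m :: "int ^ 'd"
  assumes "h > 0" "0 < s" "s < 1" "m \<noteq> 0"
  shows "(LINT \<mu>:{0<..}|lborel. \<mu> powr s * resolvent_kernel \<mu> m)
       = Gamma (1 + s) * h powr (2 * s) * \<bar>Gamma (- s)\<bar> * frac_kernel h s m"
proof -
  have "- s \<notin> \<int>\<^sub>\<le>\<^sub>0"
  proof
    assume "- s \<in> \<int>\<^sub>\<le>\<^sub>0"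
    then obtain n where "- s = - real n" by (elim nonpos_Ints_cases') auto
    with assms show False by simp
  qed
  then have "Gamma (- s) \<noteq> 0" by (simp add: Gamma_eq_zero_iff)
  then show ?thesis
    using assms by (simp add: resolvent_subordination(2) frac_kernel_eq_heat)
qed

section \<open>Square-summable functions on the lattice\<close>

definition square_summable :: "('a \<Rightarrow> real) \<Rightarrow> bool" where
  "square_summable f \<longleftrightarrow> (\<lambda>j. (f j)\<^sup>2) summable_on UNIV"

lemma square_summable_mult:
  assumes "square_summable f" "square_summable g"
  shows "(\<lambda>j. f j * g j) summable_on UNIV"
proof (rule abs_summable_summable)
  show "(\<lambda>j. norm (f j * g j)) summable_on UNIV"
    using assms by (rule_tac abs_summable_product)
      (simp_all add: square_summable_def power2_eq_square abs_mult)
qed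

lemma square_summable_bij:
  assumes "square_summable f" "bij p"
  shows "square_summable (\<lambda>j. f (p j))"
  using assms summable_on_reindex_bij_betw[of p UNIV UNIV "\<lambda>j. (f j)\<^sup>2"] by (simp add: square_summable_def)

lemma square_summable_mono:
  assumes "square_summable f" "\<And>j. \<bar>g j\<bar> \<le> \<bar>f j\<bar>"
  shows "square_summable g"
  using assms unfolding square_summable_def
  by (rule_tac summable_on_comparison_test[of "\<lambda>j. (f j)\<^sup>2"]) (auto simp: abs_le_square_iff)

lemma square_summable_shift:
  fixes f :: "'a :: ab_group_add \<Rightarrow> real"
  assumes "square_summable f"
  shows "square_summable (\<lambda>j. f (j + a))" "square_summable (\<lambda>j. f (j - a))"
proof -
  have "bij (\<lambda>j. j + a)" "bij (\<lambda>j. j - a)"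
    by (rule o_bij[of "\<lambda>j. j - a"] o_bij[of "\<lambda>j. j + a"]; force)+
  then show "square_summable (\<lambda>j. f (j + a))" "square_summable (\<lambda>j. f (j - a))"
    using square_summable_bij[OF assms] by blast+
qed

lemma square_summable_bounded:
  assumes "square_summable f"
  shows "\<exists>B. \<forall>j. \<bar>f j\<bar> \<le> B"
proof (intro exI allI)
  fix j
  have "(f j)\<^sup>2 \<le> (\<Sum>\<^sub>\<infinity>j. (f j)\<^sup>2)"
    using finite_sum_le_infsum[of "\<lambda>j. (f j)\<^sup>2" UNIV "{j}"] assms by (simp add: square_summable_def)
  then show "\<bar>f j\<bar> \<le> sqrt (\<Sum>\<^sub>\<infinity>j. (f j)\<^sup>2)"
    by (simp add: real_le_rsqrt)
qed

lemma has_sum_finite_sum: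
  fixes f :: "'i \<Rightarrow> 'a \<Rightarrow> real"
  assumes "\<And>i. i \<in> I \<Longrightarrow> (f i has_sum s i) A"
  shows "((\<lambda>x. \<Sum>i\<in>I. f i x) has_sum (\<Sum>i\<in>I. s i)) A"
  using assms
proof (induction I rule: infinite_finite_induct)
  case (insert i I)
  have "((\<lambda>x. f i x + (\<Sum>i\<in>I. f i x)) has_sum (s i + (\<Sum>i\<in>I. s i))) A"
    using insert by (intro has_sum_add) auto
  then show ?case using insert by simp
qed auto

lemma has_sum_diff:
  fixes f g :: "'a \<Rightarrow> real"
  assumes "(f has_sum a) A" "(g has_sum b) A"
  shows "((\<lambda>x. f x - g x) has_sum a - b) A"
  using has_sum_add[OF assms(1) has_sum_cmult_right[OF assms(2), of "- 1"]] by simp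

section \<open>Reflection positivity\<close>

text \<open>
The operator \<open>\<mu> - \<Delta>\<close>, where \<open>\<Delta>\<close> is the nearest-neighbour Laplacian of \<open>\<int>\<^sup>d\<close>.
\<close>

definition shifted_laplacian :: "real \<Rightarrow> (int ^ 'd \<Rightarrow> real) \<Rightarrow> int ^ 'd \<Rightarrow> real" where
  "shifted_laplacian \<mu> f j =
     (\<mu> + 2 * real CARD('d)) * f j - (\<Sum>i\<in>UNIV. f (j + axis i 1) + f (j - axis i 1))"

lemma has_sum_shift:
  fixes f g :: "'a :: ab_group_add \<Rightarrow> real"
  assumes "square_summable f" "square_summable g"
  shows "((\<lambda>j. f (j + a) * g j) has_sum (\<Sum>\<^sub>\<infinity>j. f j * g (j - a))) UNIV"
proof -
  have *: "((\<lambda>j. f j * g (j - a)) has_sum (\<Sum>\<^sub>\<infinity>j. f j * g (j - a))) UNIV"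
    by (intro has_sum_infsum square_summable_mult square_summable_shift assms)
  show ?thesis
    by (rule has_sum_reindex_bij_witness[THEN iffD1, OF _ _ _ _ _ refl *,
          of "\<lambda>j. j + a" "\<lambda>j. j - a"]) auto
qed

lemma shifted_laplacian_has_sum:
  fixes f g :: "int ^ 'd \<Rightarrow> real"
  assumes "square_summable f" "square_summable g"
  shows "((\<lambda>j. shifted_laplacian \<mu> f j * g j) has_sum
     ((\<mu> + 2 * real CARD('d)) * (\<Sum>\<^sub>\<infinity>j. f j * g j)
       - (\<Sum>i\<in>UNIV. (\<Sum>\<^sub>\<infinity>j. f j * g (j - axis i 1)) + (\<Sum>\<^sub>\<infinity>j. f j * g (j + axis i 1))))) UNIV"
proof -
  have "((\<lambda>j. (\<mu> + 2 * real CARD('d)) * (f j * g j) - (\<Sum>i\<in>UNIV. f (j + axis i 1) * g j + f (j + (- axis i 1)) * g j))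
      has_sum ((\<mu> + 2 * real CARD('d)) * (\<Sum>\<^sub>\<infinity>j. f j * g j)
       - (\<Sum>i\<in>UNIV. (\<Sum>\<^sub>\<infinity>j. f j * g (j - axis i 1)) + (\<Sum>\<^sub>\<infinity>j. f j * g (j - (- axis i 1)))))) UNIV"
    by (intro has_sum_diff has_sum_finite_sum has_sum_add has_sum_cmult_right has_sum_shift
        has_sum_infsum square_summable_mult assms)
  then show ?thesis
    by (simp add: shifted_laplacian_def sum_distrib_right sum_distrib_left left_diff_distrib distrib_right mult.assoc)
qed

lemma shifted_laplacian_symmetric:
  fixes f g :: "int ^ 'd \<Rightarrow> real"
  assumes "square_summable f" "square_summable g"
  shows "(\<Sum>\<^sub>\<infinity>j. shifted_laplacian \<mu> f j * g j) = (\<Sum>\<^sub>\<infinity>j. f j * shifted_laplacian \<mu> g j)"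
proof -
  have sw: "(\<Sum>\<^sub>\<infinity>j. f j * g (j - a)) = (\<Sum>\<^sub>\<infinity>j. g j * f (j + a))" for a
    using has_sum_shift[OF assms, of a] by (simp add: infsumI mult.commute)
  have sw': "(\<Sum>\<^sub>\<infinity>j. f j * g (j + a)) = (\<Sum>\<^sub>\<infinity>j. g j * f (j - a))" for a
    using sw[of "- a"] by simp
  have c: "(\<Sum>\<^sub>\<infinity>j. f j * g j) = (\<Sum>\<^sub>\<infinity>j. g j * f j)" by (simp add: mult.commute)
  have "(\<Sum>\<^sub>\<infinity>j. shifted_laplacian \<mu> f j * g j) = (\<Sum>\<^sub>\<infinity>j. shifted_laplacian \<mu> g j * f j)"
    unfolding infsumI[OF shifted_laplacian_has_sum[OF assms]]
      infsumI[OF shifted_laplacian_has_sum[OF assms(2,1)]] sw sw' c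
    by (simp add: add.commute)
  then show ?thesis by (simp add: mult.commute)
qed

text \<open>
Summation by parts turns the right-hand side into \<open>\<mu>\<parallel>w\<parallel>\<^sup>2\<close> plus the Dirichlet energies in all
\<open>d\<close> directions. The energy in direction \<open>l\<close> is kept because for a function cut off at a hyperplane
it sees the jump there.
\<close>

lemma shifted_laplacian_coercive:
  fixes w :: "int ^ 'd \<Rightarrow> real"
  assumes w: "square_summable w"
  shows "\<mu> * (\<Sum>\<^sub>\<infinity>j. (w j)\<^sup>2) + (\<Sum>\<^sub>\<infinity>j. (w (j + axis l 1) - w j)\<^sup>2)
    \<le> (\<Sum>\<^sub>\<infinity>j. shifted_laplacian \<mu> w j * w j)"
proof -
  define N where "N = (\<Sum>\<^sub>\<infinity>j. w j * w j)"
  define X where "X i = (\<Sum>\<^sub>\<infinity>j. w j * w (j + axis i 1))" for i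
  have X': "(\<Sum>\<^sub>\<infinity>j. w j * w (j - axis i 1)) = X i" for i
    using has_sum_shift[OF w w, of "axis i 1"] by (simp add: infsumI X_def mult.commute)
  have D: "((\<lambda>j. (w (j + axis i 1) - w j)\<^sup>2) has_sum (2 * N - 2 * X i)) UNIV" for i
  proof -
    have 1: "((\<lambda>j. w j * w j) has_sum N) UNIV"
      unfolding N_def by (intro has_sum_infsum square_summable_mult w)
    have 2: "((\<lambda>j. w (j + axis i 1) * w (j + axis i 1)) has_sum N) UNIV"
      by (rule has_sum_reindex_bij_witness[THEN iffD1, OF _ _ _ _ _ refl 1,
          of "\<lambda>j. j + axis i 1" "\<lambda>j. j - axis i 1"]) auto
    have 3: "((\<lambda>j. w j * w (j + axis i 1)) has_sum X i) UNIV"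
      unfolding X_def by (intro has_sum_infsum square_summable_mult square_summable_shift w)
    have "((\<lambda>j. w (j + axis i 1) * w (j + axis i 1) + w j * w j - 2 * (w j * w (j + axis i 1)))
        has_sum (N + N - 2 * X i)) UNIV"
      by (intro has_sum_add has_sum_diff has_sum_cmult_right 1 2 3)
    then show ?thesis by (simp add: power2_eq_square algebra_simps)
  qed
  have "(\<Sum>\<^sub>\<infinity>j. shifted_laplacian \<mu> w j * w j) = (\<mu> + 2 * real CARD('d)) * N - (\<Sum>i\<in>UNIV. X i + X i)"
    using infsumI[OF shifted_laplacian_has_sum[OF w w, of \<mu>]] by (simp add: X' X_def[symmetric] N_def)
  also have "\<dots> = \<mu> * N + (\<Sum>i\<in>UNIV. 2 * N - 2 * X i)"
    by (simp add: sum_subtractf sum.distrib algebra_simps sum_distrib_left)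
  finally have eq: "(\<Sum>\<^sub>\<infinity>j. shifted_laplacian \<mu> w j * w j) = \<mu> * N + (\<Sum>i\<in>UNIV. 2 * N - 2 * X i)" .
  have "2 * N - 2 * X l \<le> (\<Sum>i\<in>UNIV. 2 * N - 2 * X i)"
    using has_sum_nonneg[OF D] by (intro member_le_sum) auto
  moreover have "(\<Sum>\<^sub>\<infinity>j. (w j)\<^sup>2) = N" by (simp add: N_def power2_eq_square)
  ultimately show ?thesis unfolding eq infsumI[OF D[of l]] by simp
qed

text \<open>
The reflection in the hyperplane halfway between the layers \<open>j\<^sub>l = -1\<close> and \<open>j\<^sub>l = 0\<close>; it exchanges
these two layers and maps no lattice point to itself.
\<close>

definition reflect :: "'d \<Rightarrow> int ^ 'd \<Rightarrow> int ^ 'd" where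
  "reflect l j = (\<chi> i. if i = l then - 1 - j $ l else j $ i)"

lemma reflect_reflect [simp]: "reflect l (reflect l j) = j"
  by (simp add: reflect_def vec_eq_iff)

lemma bij_reflect: "bij (reflect l)"
  by (rule o_bij[of "reflect l"]) (auto simp: fun_eq_iff)

lemma reflect_component [simp]: "reflect l j $ l = - 1 - j $ l"
  by (simp add: reflect_def)

lemma shifted_laplacian_reflect:
  "shifted_laplacian \<mu> (\<lambda>j. v (reflect l j)) j = shifted_laplacian \<mu> v (reflect l j)"
proof -
  have "reflect l (j + axis i 1) = (if i = l then reflect l j - axis i 1 else reflect l j + axis i 1)"
    "reflect l (j - axis i 1) = (if i = l then reflect l j + axis i 1 else reflect l j - axis i 1)" for i
    by (auto simp: reflect_def vec_eq_iff axis_def)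
  then have "(\<Sum>i\<in>UNIV. v (reflect l (j + axis i 1)) + v (reflect l (j - axis i 1)))
     = (\<Sum>i\<in>UNIV. v (reflect l j + axis i 1) + v (reflect l j - axis i 1))"
    by (intro sum.cong) auto
  then show ?thesis by (simp add: shifted_laplacian_def)
qed

text \<open>
Cutting \<open>v\<close> off below the layer \<open>0\<close> removes the bonds between the layers \<open>-1\<close> and \<open>0\<close>. The two
extra terms are what these bonds contribute at their two ends.
\<close>

lemma shifted_laplacian_truncate:
  fixes v :: "int ^ 'd \<Rightarrow> real"
  shows "shifted_laplacian \<mu> (\<lambda>j. if 0 \<le> j $ l then v j else 0) j
     = (if 0 \<le> j $ l then shifted_laplacian \<mu> v j else 0)
       + (if j $ l = 0 then v (j - axis l 1) else 0) - (if j $ l = - 1 then v (j + axis l 1) else 0)"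
proof -
  let ?w = "\<lambda>j. if 0 \<le> j $ l then v j else 0"
  have "(\<Sum>i\<in>UNIV - {l}. ?w (j + axis i 1) + ?w (j - axis i 1))
      = (\<Sum>i\<in>UNIV - {l}. if 0 \<le> j $ l then v (j + axis i 1) + v (j - axis i 1) else 0)"
    by (intro sum.cong) (auto simp: axis_def)
  also have "\<dots> = (if 0 \<le> j $ l then \<Sum>i\<in>UNIV - {l}. v (j + axis i 1) + v (j - axis i 1) else 0)"
    by simp
  finally have rest: "(\<Sum>i\<in>UNIV - {l}. ?w (j + axis i 1) + ?w (j - axis i 1)) = \<dots>" .
  show ?thesis
    unfolding shifted_laplacian_def sum.remove[of UNIV l, OF finite UNIV_I] rest
    by (auto simp: axis_def)
qed

text \<open>
Let \<open>w\<close> be \<open>v\<close> cut off to the half-space, let \<open>a\<close> be the values of \<open>v\<close> on the layer \<open>0\<close>, and let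
\<open>b\<close> be its values on the layer \<open>-1\<close>, moved to the layer \<open>0\<close>. As \<open>v\<close> solves the homogeneous equation on the
half-space, \<open>(\<mu> - \<Delta>) w\<close> lives on the two layers, and it gives two identities. Testing it with
\<open>w\<close> yields \<open>\<langle>a, b\<rangle>\<close>, which by coercivity is at least \<open>\<mu>\<parallel>w\<parallel>\<^sup>2 + \<parallel>a\<parallel>\<^sup>2\<close>; here \<open>\<parallel>a\<parallel>\<^sup>2\<close> is the jump of
\<open>w\<close> across the hyperplane. Testing it with \<open>v \<circ> R\<close>, and moving \<open>\<mu> - \<Delta>\<close> to the other side, shows
that the reflected pairing equals \<open>\<parallel>b\<parallel>\<^sup>2 - \<parallel>a\<parallel>\<^sup>2\<close>. Since \<open>2\<langle>a, b\<rangle> \<le> \<parallel>a\<parallel>\<^sup>2 + \<parallel>b\<parallel>\<^sup>2\<close>, the claim follows.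
\<close>

theorem reflection_positivity:
  fixes v :: "int ^ 'd \<Rightarrow> real"
  assumes v: "square_summable v"
    and zero: "\<And>j. 0 \<le> j $ l \<Longrightarrow> shifted_laplacian \<mu> v j = 0"
  shows "2 * \<mu> * (\<Sum>\<^sub>\<infinity>j. if 0 \<le> j $ l then (v j)\<^sup>2 else 0)
     \<le> (\<Sum>\<^sub>\<infinity>j. shifted_laplacian \<mu> v (reflect l j) * v j)"
proof -
  define e :: "int ^ 'd" where "e = axis l 1"
  define w where "w j = (if 0 \<le> j $ l then v j else 0)" for j
  define a where "a j = (if j $ l = 0 then v j else 0)" for j
  define b where "b j = (if j $ l = 0 then v (j - e) else 0)" for j
  have e: "e $ l = 1" by (auto simp: e_def axis_def)
  have w2: "square_summable w" and a2: "square_summable a" and b2: "square_summable b"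
    by (rule square_summable_mono[OF v] square_summable_mono[OF square_summable_shift(2)[OF v, of e]];
        simp add: w_def a_def b_def)+
  have vR2: "square_summable (\<lambda>j. v (reflect l j))"
    by (rule square_summable_bij[OF v bij_reflect])
  have Lw: "shifted_laplacian \<mu> w j = b j - a (j + e)" for j
    using shifted_laplacian_truncate[of \<mu> l v j] zero[of j]
    by (auto simp: w_def[abs_def] a_def b_def e_def[symmetric] e)
  define A where "A = (\<Sum>\<^sub>\<infinity>j. (a j)\<^sup>2)"
  define B where "B = (\<Sum>\<^sub>\<infinity>j. (b j)\<^sup>2)"
  have hA: "((\<lambda>j. (a j)\<^sup>2) has_sum A) UNIV" and hB: "((\<lambda>j. (b j)\<^sup>2) has_sum B) UNIV"
    using a2 b2 unfolding A_def B_def square_summable_def by auto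
  have hA': "((\<lambda>j. (a (j + e))\<^sup>2) has_sum A) UNIV"
    by (rule has_sum_reindex_bij_witness[THEN iffD1, OF _ _ _ _ _ refl hA, of "\<lambda>j. j + e" "\<lambda>j. j - e"]) auto
  \<comment> \<open>the term at a site of the layer \<open>-1\<close> is the square of the value of \<open>v\<close> just above it\<close>
  have "A \<le> (\<Sum>\<^sub>\<infinity>j. (w (j + e) - w j)\<^sup>2)"
  proof (rule has_sum_mono[OF hA' has_sum_infsum])
    have "square_summable (\<lambda>j. w (j + e))" by (rule square_summable_shift[OF w2])
    from square_summable_mult[OF this this] square_summable_mult[OF this w2] square_summable_mult[OF w2 w2]
    have "(\<lambda>j. w (j + e) * w (j + e) + w j * w j + (- 2) * (w (j + e) * w j)) summable_on UNIV"
      by (intro summable_on_add summable_on_cmult_right)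
    then show "(\<lambda>j. (w (j + e) - w j)\<^sup>2) summable_on UNIV"
      by (simp add: power2_eq_square algebra_simps)
  qed (auto simp: a_def w_def e)
  then have lower: "\<mu> * (\<Sum>\<^sub>\<infinity>j. (w j)\<^sup>2) + A \<le> (\<Sum>\<^sub>\<infinity>j. shifted_laplacian \<mu> w j * w j)"
    using shifted_laplacian_coercive[OF w2, of \<mu> l] by (simp add: e_def)
  have "shifted_laplacian \<mu> w j * w j = a j * b j" for j
    unfolding Lw by (auto simp: a_def b_def w_def e)
  then have "(\<Sum>\<^sub>\<infinity>j. shifted_laplacian \<mu> w j * w j) = (\<Sum>\<^sub>\<infinity>j. a j * b j)" by simp
  also have "\<dots> \<le> (A + B) / 2"
  proof (rule has_sum_mono[OF has_sum_infsum[OF square_summable_mult[OF a2 b2]]])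
    show "((\<lambda>j. ((a j)\<^sup>2 + (b j)\<^sup>2) / 2) has_sum (A + B) / 2) UNIV"
      unfolding divide_inverse by (intro has_sum_cmult_left has_sum_add hA hB)
    show "a j * b j \<le> ((a j)\<^sup>2 + (b j)\<^sup>2) / 2" for j
      using sum_squares_bound[of "a j" "b j"] by (simp add: field_simps)
  qed
  finally have upper: "(\<Sum>\<^sub>\<infinity>j. shifted_laplacian \<mu> w j * w j) \<le> (A + B) / 2" .
  have "shifted_laplacian \<mu> v (reflect l j) * v j = shifted_laplacian \<mu> (\<lambda>j. v (reflect l j)) j * w j" for j
    unfolding shifted_laplacian_reflect using zero[of "reflect l j"] by (auto simp: w_def)
  then have "(\<Sum>\<^sub>\<infinity>j. shifted_laplacian \<mu> v (reflect l j) * v j)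
      = (\<Sum>\<^sub>\<infinity>j. v (reflect l j) * shifted_laplacian \<mu> w j)"
    by (simp add: shifted_laplacian_symmetric[OF vR2 w2])
  also have "\<dots> = (\<Sum>\<^sub>\<infinity>j. (b j)\<^sup>2 - (a (j + e))\<^sup>2)"
  proof (intro infsum_cong)
    fix j
    have "reflect l j = (if j $ l = 0 then j - e else j + e)" if "j $ l = 0 \<or> j $ l = - 1"
      using that by (auto simp: reflect_def e_def vec_eq_iff axis_def)
    then show "v (reflect l j) * shifted_laplacian \<mu> w j = (b j)\<^sup>2 - (a (j + e))\<^sup>2"
      unfolding Lw by (auto simp: a_def b_def e power2_eq_square)
  qed
  also have "\<dots> = B - A" by (intro infsumI has_sum_diff hB hA')
  finally have "(\<Sum>\<^sub>\<infinity>j. shifted_laplacian \<mu> v (reflect l j) * v j) = B - A" .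
  moreover have "(\<Sum>\<^sub>\<infinity>j. (w j)\<^sup>2) = (\<Sum>\<^sub>\<infinity>j. if 0 \<le> j $ l then (v j)\<^sup>2 else 0)"
    by (intro infsum_cong) (auto simp: w_def)
  ultimately show ?thesis using lower upper by (simp add: field_simps)
qed

section \<open>Convolution with summable kernels\<close>

lemma convolution_pairs_summable:
  fixes f g :: "'a :: ab_group_add \<Rightarrow> real"
  assumes f: "f summable_on UNIV" "\<And>j. 0 \<le> f j" and g: "g summable_on UNIV" "\<And>j. 0 \<le> g j"
  shows "(\<lambda>(j, m). f (j - m) * g m) summable_on UNIV"
proof -
  have "(\<lambda>(m, n). g m * f n) summable_on (SIGMA m:UNIV. UNIV)"
  proof (rule summable_on_SigmaI[where g = "\<lambda>m. g m * infsum f UNIV"])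
    show "((\<lambda>n. case (m, n) of (m, n) \<Rightarrow> g m * f n) has_sum g m * infsum f UNIV) UNIV" for m
      using f by (simp add: has_sum_cmult_right)
    show "(\<lambda>m. g m * infsum f UNIV) summable_on UNIV"
      by (intro summable_on_cmult_left g)
  qed (auto intro!: mult_nonneg_nonneg f g)
  then show ?thesis
    by (subst summable_on_reindex_bij_witness[where i = "\<lambda>(m, n). (n + m, m)" and j = "\<lambda>(j, m). (m, j - m)"
          and T = "UNIV \<times> UNIV" and h = "\<lambda>(m, n). g m * f n"]) auto
qed

lemma convolution_summable:
  fixes f u :: "'a :: ab_group_add \<Rightarrow> real"
  assumes f: "f summable_on UNIV" "\<And>j. 0 \<le> f j" and u: "square_summable u"
  shows "(\<lambda>m. f (j - m) * u m) summable_on UNIV"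
    and "(\<lambda>m. f (j - m) * \<bar>u m\<bar>) summable_on UNIV"
proof -
  obtain B where B: "\<And>j. \<bar>u j\<bar> \<le> B" using square_summable_bounded[OF u] by blast
  have "(\<lambda>m. f (j - m)) summable_on UNIV"
    using f(1) by (subst summable_on_reindex_bij_witness[where i = "\<lambda>m. j - m" and j = "\<lambda>m. j - m"]) auto
  then have "(\<lambda>m. f (j - m) * B) summable_on UNIV" by (rule summable_on_cmult_left)
  then show "(\<lambda>m. f (j - m) * \<bar>u m\<bar>) summable_on UNIV"
    by (rule summable_on_comparison_test) (auto intro!: mult_left_mono mult_nonneg_nonneg B f)
  then show "(\<lambda>m. f (j - m) * u m) summable_on UNIV"
    using f by (rule_tac abs_summable_summable) (simp add: abs_mult)
qed

text \<open>
The case \<open>\<ell>\<^sup>1 * \<ell>\<^sup>2 \<subseteq> \<ell>\<^sup>2\<close> of Young's inequality: by Cauchy-Schwarz for the weights \<open>f(j - m)\<close>, the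
square of the convolution is at most \<open>\<parallel>f\<parallel>\<^sub>1\<close> times \<open>(f * u\<^sup>2)(j)\<close>, which is summable over \<open>j\<close>.
\<close>

lemma convolution_square_summable:
  fixes f u :: "'a :: ab_group_add \<Rightarrow> real"
  assumes f: "f summable_on UNIV" "\<And>j. 0 \<le> f j" and u: "square_summable u"
  shows "square_summable (\<lambda>j. \<Sum>\<^sub>\<infinity>m. f (j - m) * u m)"
proof -
  define S where "S = infsum f UNIV"
  define T where "T j = (\<Sum>\<^sub>\<infinity>m. f (j - m) * (u m)\<^sup>2)" for j
  have u2: "(\<lambda>m. (u m)\<^sup>2) summable_on UNIV"
    using u by (simp only: square_summable_def)
  have pairs: "(\<lambda>(j, m). f (j - m) * (u m)\<^sup>2) summable_on UNIV \<times> UNIV"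
    unfolding UNIV_Times_UNIV by (rule convolution_pairs_summable[OF f u2]) (rule zero_le_power2)
  have T: "T summable_on UNIV"
    using summable_on_Sigma_banach[OF pairs] by (simp add: T_def[abs_def])
  have row: "(\<lambda>m. f (j - m) * (u m)\<^sup>2) summable_on UNIV" for j
    using summable_on_SigmaD1[OF pairs, of j] by simp
  have "(\<Sum>\<^sub>\<infinity>m. f (j - m) * u m)\<^sup>2 \<le> S * T j" for j
  proof -
    have fj: "(\<Sum>m\<in>F. f (j - m)) \<le> S" if "finite F" for F
    proof -
      have "(\<Sum>m\<in>F. f (j - m)) = sum f ((\<lambda>m. j - m) ` F)"
        by (subst sum.reindex) (auto simp: inj_on_def)
      also have "\<dots> \<le> S" unfolding S_def using that f by (intro finite_sum_le_infsum) auto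
      finally show ?thesis .
    qed
    have ST: "0 \<le> S" "0 \<le> T j" unfolding S_def T_def using f by (auto intro!: infsum_nonneg)
    have "(\<Sum>\<^sub>\<infinity>m. f (j - m) * \<bar>u m\<bar>) \<le> sqrt (S * T j)"
    proof (rule infsum_le_finite_sums)
      fix F :: "'a set" assume F: "finite F"
      have "(\<Sum>m\<in>F. f (j - m) * \<bar>u m\<bar>)\<^sup>2 = (\<Sum>m\<in>F. sqrt (f (j - m)) * (sqrt (f (j - m)) * \<bar>u m\<bar>))\<^sup>2"
        using f by (simp add: mult.assoc[symmetric])
      also have "\<dots> \<le> (\<Sum>m\<in>F. (sqrt (f (j - m)))\<^sup>2) * (\<Sum>m\<in>F. (sqrt (f (j - m)) * \<bar>u m\<bar>)\<^sup>2)"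
        by (rule Cauchy_Schwarz_ineq_sum)
      also have "\<dots> = (\<Sum>m\<in>F. f (j - m)) * (\<Sum>m\<in>F. f (j - m) * (u m)\<^sup>2)"
        using f by (simp add: power_mult_distrib)
      also have "\<dots> \<le> S * T j"
      proof (intro mult_mono fj F ST)
        show "(\<Sum>m\<in>F. f (j - m) * (u m)\<^sup>2) \<le> T j"
          unfolding T_def using f F row by (intro finite_sum_le_infsum) auto
      qed (auto intro!: sum_nonneg mult_nonneg_nonneg f)
      finally show "(\<Sum>m\<in>F. f (j - m) * \<bar>u m\<bar>) \<le> sqrt (S * T j)" by (rule real_le_rsqrt)
    qed (rule convolution_summable(2)[OF f u])
    moreover have "\<bar>\<Sum>\<^sub>\<infinity>m. f (j - m) * u m\<bar> \<le> (\<Sum>\<^sub>\<infinity>m. f (j - m) * \<bar>u m\<bar>)"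
      using norm_infsum_bound[of "\<lambda>m. f (j - m) * u m" UNIV] convolution_summable(2)[OF f u, of j] f
      by (simp add: abs_mult)
    ultimately have "\<bar>\<Sum>\<^sub>\<infinity>m. f (j - m) * u m\<bar> \<le> sqrt (S * T j)" by linarith
    then have "\<bar>\<Sum>\<^sub>\<infinity>m. f (j - m) * u m\<bar>\<^sup>2 \<le> (sqrt (S * T j))\<^sup>2" by (intro power_mono) auto
    then show ?thesis using ST by simp
  qed
  then show ?thesis
    unfolding square_summable_def
    by (intro summable_on_comparison_test[OF summable_on_cmult_right[OF T, of S]]) auto
qed

section \<open>Characters on the frequency box\<close>

definition character :: "real \<Rightarrow> int ^ 'd \<Rightarrow> real ^ 'd \<Rightarrow> complex" where
  "character h k \<xi> = exp (- \<i> * of_real (phase h \<xi> k))"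

lemma character_add: "character h (k + m) \<xi> = character h k \<xi> * character h m \<xi>"
  by (simp add: character_def phase_def exp_add[symmetric] sum.distrib algebra_simps)

lemma character_zero [simp]: "character h 0 \<xi> = 1"
  by (simp add: character_def phase_def)

lemma cnj_character: "cnj (character h k \<xi>) = exp (\<i> * of_real (phase h \<xi> k))"
  by (simp add: character_def exp_cnj)

lemma cnj_character_minus: "cnj (character h k \<xi>) = character h (- k) \<xi>"
  by (simp add: cnj_character) (simp add: character_def phase_def sum_negf)

lemma norm_character [simp]: "cmod (character h k \<xi>) = 1"
  by (simp add: character_def)

lemma continuous_character: "continuous_on S (character h k)"
  unfolding character_def phase_def by (intro continuous_intros)

text \<open>
Fubini's theorem for product functions, transported from the product measure indexed by the
standard basis to the Lebesgue measure of \<open>\<real>\<^sup>d\<close>.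
\<close>

lemma lborel_integral_prod:
  fixes f :: "'d::finite \<Rightarrow> real \<Rightarrow> complex"
  assumes "\<And>i. integrable lborel (f i)"
  shows "(LINT x|(lborel :: (real ^ 'd) measure). (\<Prod>i\<in>UNIV. f i (x $ i))) = (\<Prod>i\<in>UNIV. (LINT t|lborel. f i t))"
proof -
  interpret product_sigma_finite "\<lambda>_ :: real ^ 'd. lborel :: real measure" ..
  let ?B = "Basis :: (real ^ 'd) set"
  have B: "?B = (\<lambda>i. axis i 1) ` UNIV" by (auto simp: Basis_vec_def)
  have inj: "inj (\<lambda>i :: 'd. axis i (1 :: real))" by (auto simp: inj_on_def axis_eq_axis)
  have coord: "(\<Sum>b\<in>?B. y b *\<^sub>R b) $ i = y (axis i 1)" for y :: "real ^ 'd \<Rightarrow> real" and i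
    unfolding B by (subst sum.reindex[OF inj]) (simp add: axis_def if_distrib[of "\<lambda>x. _ * x"] cong: if_cong)
  have m: "(\<lambda>x :: real ^ 'd. \<Prod>i\<in>UNIV. f i (x $ i)) \<in> borel_measurable borel"
  proof (intro borel_measurable_prod)
    fix i
    have "f i \<in> borel_measurable borel" using borel_measurable_integrable[OF assms[of i]] by simp
    moreover have "(\<lambda>x :: real ^ 'd. x $ i) \<in> borel_measurable borel"
      by (intro borel_measurable_continuous_onI continuous_intros)
    ultimately show "(\<lambda>x :: real ^ 'd. f i (x $ i)) \<in> borel_measurable borel"
      by (rule measurable_compose_rev)
  qed
  have "(LINT x|(lborel :: (real ^ 'd) measure). (\<Prod>i\<in>UNIV. f i (x $ i)))
      = (LINT y|(\<Pi>\<^sub>M b\<in>?B. lborel). (\<Prod>i\<in>UNIV. f i ((\<Sum>b\<in>?B. y b *\<^sub>R b) $ i)))"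
    by (subst lborel_eq, subst integral_distr) (use m in auto)
  also have "\<dots> = (LINT y|(\<Pi>\<^sub>M b\<in>?B. lborel). (\<Prod>b\<in>?B. f (axis_index b) (y b)))"
    unfolding coord unfolding B by (subst prod.reindex[OF inj]) simp
  also have "\<dots> = (\<Prod>b\<in>?B. (LINT t|lborel. f (axis_index b) t))"
    by (rule product_integral_prod) (auto intro: assms)
  also have "\<dots> = (\<Prod>i\<in>UNIV. (LINT t|lborel. f i t))"
    unfolding B by (subst prod.reindex[OF inj]) simp
  finally show ?thesis .
qed

lemma exponential_integral:
  fixes k :: int
  assumes "0 < h"
  shows "integrable lborel (\<lambda>x. indicator {- pi / h..<pi / h} x *\<^sub>R exp (- \<i> * of_real (h * x * of_int k)))"
    and "(LINT x|lborel. indicator {- pi / h..<pi / h} x *\<^sub>R exp (- \<i> * of_real (h * x * of_int k)))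
      = (if k = 0 then of_real (2 * pi / h) else 0)"
proof -
  let ?e = "\<lambda>x::real. exp (- \<i> * of_real (h * x * of_int k))"
  have int: "integrable lborel (\<lambda>x. indicator {- pi / h..pi / h} x *\<^sub>R ?e x)"
    by (intro borel_integrable_compact continuous_intros) auto
  from integrable_mult_indicator[OF _ this, of "{- pi / h..<pi / h}"]
  show "integrable lborel (\<lambda>x. indicator {- pi / h..<pi / h} x *\<^sub>R ?e x)"
    by (rule Bochner_Integration.integrable_cong[THEN iffD1, rotated -1]) (auto simp: indicator_def)
  have "(LINT x|lborel. indicator {- pi / h..<pi / h} x *\<^sub>R ?e x)
      = (LINT x|lborel. indicator {- pi / h..pi / h} x *\<^sub>R ?e x)"
    by (rule integral_cong_AE)
       (use AE_lborel_singleton[of "pi / h"] in \<open>auto simp: indicator_def elim!: eventually_mono\<close>)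
  also have "\<dots> = (if k = 0 then of_real (2 * pi / h) else 0)"
  proof (cases "k = 0")
    case True
    then show ?thesis using assms
      by (simp add: field_simps scaleR_conv_of_real integral_complex_of_real del: of_real_divide)
  next
    case False
    \<comment> \<open>the primitive takes equal values at the two ends of a full period\<close>
    let ?c = "- \<i> * of_real (h * of_int k)"
    have c: "?c \<noteq> 0" using False assms by auto
    have "(LINT x|lborel. indicator {- pi / h..pi / h} x *\<^sub>R ?e x)
        = exp (?c * of_real (pi / h)) / ?c - exp (?c * of_real (- pi / h)) / ?c"
    proof (rule integral_FTC_atLeastAtMost)
      show "((\<lambda>x. exp (?c * of_real x) / ?c) has_vector_derivative ?e x) (at x within {- pi / h..pi / h})" for x
        by (rule has_vector_derivative_real_field derivative_eq_intros refl | use c in \<open>simp add: algebra_simps\<close>)+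
    qed (use assms in \<open>auto intro!: continuous_intros\<close>)
    also have "exp (?c * of_real (- pi / h)) = exp (?c * of_real (pi / h)) * exp (\<i> * (of_int k * (of_real pi * 2)))"
      unfolding exp_add[symmetric] using assms by (intro arg_cong[of _ _ exp]) (simp add: field_simps)
    finally show ?thesis using False by simp
  qed
  finally show "(LINT x|lborel. indicator {- pi / h..<pi / h} x *\<^sub>R ?e x)
      = (if k = 0 then of_real (2 * pi / h) else 0)" .
qed

lemma character_integral:
  fixes k :: "int ^ 'd"
  assumes "0 < h"
  shows "of_real ((h / (2 * pi)) ^ CARD('d)) * (LINT \<xi>:freq_box h|lborel. character h k \<xi>) = (if k = 0 then 1 else 0)"
proof -
  let ?f = "\<lambda>i x. indicator {- pi / h..<pi / h} x *\<^sub>R exp (- \<i> * of_real (h * x * of_int (k $ i)))"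
  have box: "indicator (freq_box h) \<xi> = (\<Prod>i\<in>UNIV. indicator {- pi / h..<pi / h} (\<xi> $ i) :: real)" for \<xi> :: "real ^ 'd"
    by (auto simp: freq_box_def indicator_def)
  have char: "character h k \<xi> = (\<Prod>i\<in>UNIV. exp (- \<i> * of_real (h * \<xi> $ i * of_int (k $ i))))" for \<xi>
    unfolding character_def phase_def
    by (simp add: exp_sum[symmetric] sum_distrib_left sum_negf mult.assoc)
  have "(LINT \<xi>:freq_box h|lborel. character h k \<xi>) = (LINT \<xi>|lborel. (\<Prod>i\<in>UNIV. ?f i (\<xi> $ i)))"
    unfolding set_lebesgue_integral_def box char by (simp add: prod.distrib scaleR_conv_of_real)
  also have "\<dots> = (\<Prod>i\<in>UNIV. if k $ i = 0 then of_real (2 * pi / h) else 0)"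
    using exponential_integral[OF assms] by (subst lborel_integral_prod) auto
  also have "\<dots> = (if k = 0 then of_real ((2 * pi / h) ^ CARD('d)) else 0)"
    by (auto simp: vec_eq_iff intro!: prod_zero)
  finally have integral: "(LINT \<xi>:freq_box h|lborel. character h k \<xi>)
      = (if k = 0 then of_real ((2 * pi / h) ^ CARD('d)) else 0)" .
  have "h / (2 * pi) * (2 * pi / h) = 1" using assms by simp
  then have "(h / (2 * pi)) ^ CARD('d) * (2 * pi / h) ^ CARD('d) = 1"
    unfolding power_mult_distrib[symmetric] by simp
  then have "complex_of_real ((h / (2 * pi)) ^ CARD('d)) * of_real ((2 * pi / h) ^ CARD('d)) = 1"
    unfolding of_real_mult[symmetric] by simp
  then show ?thesis unfolding integral by simp
qed

section \<open>Mean values over the frequency box and Fourier coefficients\<close>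

text \<open>
The mean value over the frequency box, whose volume is \<open>(2\<pi>/h)\<^sup>d\<close>. Under the inner product
\<open>box_mean h (F * cnj G)\<close> the characters are orthonormal.
\<close>

definition box_mean :: "real \<Rightarrow> (real ^ 'd \<Rightarrow> complex) \<Rightarrow> complex" where
  "box_mean h F = of_real ((h / (2 * pi)) ^ CARD('d)) * (LINT \<xi>:freq_box h|lborel. F \<xi>)"

lemma inv_fourier_eq_box_mean:
  "inv_fourier h F k = box_mean h (\<lambda>\<xi>. F \<xi> * cnj (character h k \<xi>))"
  by (simp add: inv_fourier_def box_mean_def cnj_character)

lemma sets_freq_box: "(freq_box h :: (real ^ 'd) set) \<in> sets borel"
proof -
  have "freq_box h = (\<Inter>i. {\<xi> :: real ^ 'd. - pi / h \<le> \<xi> $ i} \<inter> {\<xi>. \<xi> $ i < pi / h})"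
    by (auto simp: freq_box_def)
  also have "\<dots> \<in> sets borel"
    by (intro sets.finite_INT sets.Int borel_closed borel_open closed_Collect_le open_Collect_less
        continuous_intros) auto
  finally show ?thesis .
qed

lemma box_integrable:
  fixes F :: "real ^ 'd \<Rightarrow> 'a :: {banach, second_countable_topology}"
  assumes "continuous_on UNIV F"
  shows "set_integrable lborel (freq_box h) F"
proof -
  let ?C = "cbox (\<chi> i. - pi / h) (\<chi> i. pi / h) :: (real ^ 'd) set"
  have "set_integrable lborel ?C F"
    unfolding set_integrable_def
    by (rule borel_integrable_compact) (auto intro: continuous_on_subset[OF assms])
  then show ?thesis
    by (rule set_integrable_subset) (auto simp: sets_freq_box freq_box_def mem_box_cart less_imp_le)
qed

lemma box_mean_add:
  assumes "continuous_on UNIV F" "continuous_on UNIV G"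
  shows "box_mean h (\<lambda>\<xi>. F \<xi> + G \<xi>) = box_mean h F + box_mean h G"
  unfolding box_mean_def
  by (simp add: set_integral_add(2)[OF box_integrable[OF assms(1)] box_integrable[OF assms(2)]] distrib_left)

lemma box_mean_cmult: "box_mean h (\<lambda>\<xi>. c * F \<xi>) = c * box_mean h F"
  by (simp add: box_mean_def)

lemma box_mean_cnj: "box_mean h (\<lambda>\<xi>. cnj (F \<xi>)) = cnj (box_mean h F)"
proof -
  have "indicator (freq_box h) \<xi> *\<^sub>R cnj (F \<xi>) = cnj (indicator (freq_box h) \<xi> *\<^sub>R F \<xi>)" for \<xi>
    by simp
  then have "(LINT \<xi>:freq_box h|lborel. cnj (F \<xi>)) = cnj (LINT \<xi>:freq_box h|lborel. F \<xi>)"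
    unfolding set_lebesgue_integral_def by (simp only: Bochner_Integration.integral_cnj)
  then show ?thesis by (simp add: box_mean_def)
qed

lemma box_mean_sum:
  assumes "\<And>k. k \<in> K \<Longrightarrow> continuous_on UNIV (F k)"
  shows "box_mean h (\<lambda>\<xi>. \<Sum>k\<in>K. F k \<xi>) = (\<Sum>k\<in>K. box_mean h (F k))"
  unfolding box_mean_def
  by (subst set_integral_finite_sum(2)) (auto simp: sum_distrib_left intro: box_integrable assms)

lemma box_mean_character: "0 < h \<Longrightarrow> box_mean h (character h k) = (if k = 0 then 1 else 0)"
  unfolding box_mean_def by (rule character_integral)

definition box_energy :: "real \<Rightarrow> (real ^ 'd \<Rightarrow> complex) \<Rightarrow> real" where
  "box_energy h F = (h / (2 * pi)) ^ CARD('d) * (LINT \<xi>:freq_box h|lborel. (cmod (F \<xi>))\<^sup>2)"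

lemma box_energy_eq_box_mean: "of_real (box_energy h F) = box_mean h (\<lambda>\<xi>. F \<xi> * cnj (F \<xi>))"
  unfolding box_energy_def box_mean_def complex_norm_square[symmetric] set_lebesgue_integral_def
  by (simp add: scaleR_conv_of_real del: of_real_power flip: of_real_mult)

lemma box_energy_nonneg: "0 < h \<Longrightarrow> 0 \<le> box_energy h F"
  unfolding box_energy_def set_lebesgue_integral_def
  by (intro mult_nonneg_nonneg Bochner_Integration.integral_nonneg) auto

lemma box_energy_mono:
  assumes "0 < h" "continuous_on UNIV F" "continuous_on UNIV G" "\<And>\<xi>. cmod (F \<xi>) \<le> cmod (G \<xi>)"
  shows "box_energy h F \<le> box_energy h G"
  unfolding box_energy_def using assms
  by (intro mult_left_mono set_integral_mono box_integrable continuous_intros power_mono) auto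

text \<open>
Expanding the square and using orthonormality. The choice \<open>a = inv_fourier h G\<close> gives Bessel's
inequality. Any other \<open>a\<close> bounds the defect of Parseval's identity by the distance from \<open>G\<close> to a
trigonometric sum.
\<close>

lemma box_energy_diff_trig_sum:
  fixes G :: "real ^ 'd \<Rightarrow> complex"
  assumes h: "0 < h" and G: "continuous_on UNIV G" and K: "finite K"
  shows "box_energy h (\<lambda>\<xi>. G \<xi> - (\<Sum>k\<in>K. a k * character h k \<xi>))
    = box_energy h G - (\<Sum>k\<in>K. (cmod (inv_fourier h G k))\<^sup>2)
      + (\<Sum>k\<in>K. (cmod (inv_fourier h G k - a k))\<^sup>2)"
proof -
  let ?e = "character h :: int ^ 'd \<Rightarrow> real ^ 'd \<Rightarrow> complex"
  let ?g = "inv_fourier h G"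
  note cont = G continuous_character
  have ge: "box_mean h (\<lambda>\<xi>. ?e k \<xi> * cnj (G \<xi>)) = cnj (?g k)" for k
    unfolding inv_fourier_eq_box_mean box_mean_cnj[symmetric] by (simp add: mult.commute)
  have ee: "box_mean h (\<lambda>\<xi>. ?e k \<xi> * cnj (?e m \<xi>)) = (if k = m then 1 else 0)" for k m
  proof -
    have "(\<lambda>\<xi>. ?e k \<xi> * cnj (?e m \<xi>)) = ?e (k - m)"
      by (simp add: cnj_character_minus character_add[symmetric] fun_eq_iff)
    then show ?thesis by (simp add: box_mean_character[OF h])
  qed
  \<comment> \<open>the opaque name keeps the sign inside the coefficient, where linearity of the mean value can pull it out\<close>
  define b where "b k = - a k" for k
  have "complex_of_real (box_energy h (\<lambda>\<xi>. G \<xi> - (\<Sum>k\<in>K. a k * ?e k \<xi>)))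
    = box_mean h (\<lambda>\<xi>. G \<xi> * cnj (G \<xi>)
        + ((\<Sum>k\<in>K. cnj (b k) * (G \<xi> * cnj (?e k \<xi>)))
        + ((\<Sum>k\<in>K. b k * (?e k \<xi> * cnj (G \<xi>)))
        + (\<Sum>k\<in>K. \<Sum>m\<in>K. (a k * cnj (a m)) * (?e k \<xi> * cnj (?e m \<xi>))))))"
    unfolding box_energy_eq_box_mean
    by (intro arg_cong[of _ _ "box_mean h"] ext)
       (simp add: algebra_simps sum_distrib_left sum_distrib_right sum_negf sum_product b_def; rule sum.swap)
  also have "\<dots> = box_mean h (\<lambda>\<xi>. G \<xi> * cnj (G \<xi>))
        + ((\<Sum>k\<in>K. cnj (b k) * ?g k)
        + ((\<Sum>k\<in>K. b k * cnj (?g k))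
        + (\<Sum>k\<in>K. \<Sum>m\<in>K. (a k * cnj (a m)) * (if k = m then 1 else 0))))"
    by (simp add: box_mean_add box_mean_sum box_mean_cmult ge ee[folded inv_fourier_eq_box_mean] inv_fourier_eq_box_mean[symmetric]
        cont continuous_intros cong: if_cong)
  also have "\<dots> = of_real (box_energy h G) + (\<Sum>k\<in>K. - cnj (a k) * ?g k - a k * cnj (?g k) + a k * cnj (a k))"
    unfolding box_energy_eq_box_mean b_def using K
    by (simp add: sum.distrib sum_subtractf sum_negf if_distrib[of "\<lambda>x. _ * x"] cong: if_cong)
  also have "(\<Sum>k\<in>K. - cnj (a k) * ?g k - a k * cnj (?g k) + a k * cnj (a k))
     = (\<Sum>k\<in>K. of_real ((cmod (?g k - a k))\<^sup>2) - of_real ((cmod (?g k))\<^sup>2))"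
    unfolding complex_norm_square by (intro sum.cong) (auto simp: algebra_simps)
  finally show ?thesis
    unfolding of_real_add[symmetric] of_real_diff[symmetric] of_real_sum[symmetric] of_real_eq_iff
    by (simp add: sum_subtractf)
qed

lemma box_energy_trig_sum:
  fixes a :: "int ^ 'd \<Rightarrow> complex"
  assumes "0 < h" "finite K"
  shows "box_energy h (\<lambda>\<xi>. \<Sum>k\<in>K. a k * character h k \<xi>) = (\<Sum>k\<in>K. (cmod (a k))\<^sup>2)"
proof -
  have "inv_fourier h (\<lambda>_. 0) k = 0" for k :: "int ^ 'd"
    by (simp add: inv_fourier_def)
  then show ?thesis
    using box_energy_diff_trig_sum[OF assms(1) continuous_on_const assms(2), of 0 a]
    by (simp add: box_energy_def)
qed

lemma bessel_inequality:
  assumes "0 < h" "continuous_on UNIV G" "finite K"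
  shows "(\<Sum>k\<in>K. (cmod (inv_fourier h G k))\<^sup>2) \<le> box_energy h G"
  using box_energy_diff_trig_sum[OF assms, of "inv_fourier h G"]
    box_energy_nonneg[OF assms(1), of "\<lambda>\<xi>. G \<xi> - (\<Sum>k\<in>K. inv_fourier h G k * character h k \<xi>)"] by simp

lemma fourier_coefficients_summable:
  fixes G :: "real ^ 'd \<Rightarrow> complex"
  assumes "0 < h" "continuous_on UNIV G"
  shows "(\<lambda>k. (cmod (inv_fourier h G k))\<^sup>2) summable_on UNIV"
  by (rule nonneg_bdd_above_summable_on) (auto intro!: bdd_aboveI2 bessel_inequality assms)

text \<open>
Completeness of the characters for those \<open>G\<close> that are uniform limits of trigonometric sums. Bessel's
inequality makes the coefficients summable, so that the infinite sum has its intended value.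
\<close>

lemma box_energy_le_coefficients:
  fixes G :: "real ^ 'd \<Rightarrow> complex"
  assumes h: "0 < h" and G: "continuous_on UNIV G"
    and approx: "\<And>\<delta>. 0 < \<delta> \<Longrightarrow>
       \<exists>K a. finite K \<and> (\<forall>\<xi>. cmod (G \<xi> - (\<Sum>k\<in>K. a k * character h k \<xi>)) \<le> \<delta>)"
  shows "box_energy h G \<le> (\<Sum>\<^sub>\<infinity>k. (cmod (inv_fourier h G k))\<^sup>2)"
proof (rule field_le_epsilon)
  fix \<epsilon> :: real assume "0 < \<epsilon>"
  then obtain K a where K: "finite K"
    and a: "\<And>\<xi>. cmod (G \<xi> - (\<Sum>k\<in>K. a k * character h k \<xi>)) \<le> sqrt \<epsilon>"
    using approx[of "sqrt \<epsilon>"] by auto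
  have "box_energy h (\<lambda>\<xi>. G \<xi> - (\<Sum>k\<in>K. a k * character h k \<xi>))
      \<le> box_energy h (\<lambda>\<xi>. \<Sum>k\<in>{0 :: int ^ 'd}. of_real (sqrt \<epsilon>) * character h k \<xi>)"
    using a \<open>0 < \<epsilon>\<close>
    by (intro box_energy_mono h continuous_intros G continuous_character) (auto simp: norm_mult)
  also have "\<dots> = \<epsilon>"
    using \<open>0 < \<epsilon>\<close> by (subst box_energy_trig_sum[OF h]) auto
  finally have "box_energy h G \<le> (\<Sum>k\<in>K. (cmod (inv_fourier h G k))\<^sup>2) + \<epsilon>"
    using box_energy_diff_trig_sum[OF h G K, of a] sum_nonneg[of K "\<lambda>k. (cmod (inv_fourier h G k - a k))\<^sup>2"]
    by simp
  also have "(\<Sum>k\<in>K. (cmod (inv_fourier h G k))\<^sup>2) \<le> (\<Sum>\<^sub>\<infinity>k. (cmod (inv_fourier h G k))\<^sup>2)"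
    by (intro finite_sum_le_infsum fourier_coefficients_summable h G K) auto
  finally show "box_energy h G \<le> (\<Sum>\<^sub>\<infinity>k. (cmod (inv_fourier h G k))\<^sup>2) + \<epsilon>" by simp
qed

section \<open>Trigonometric polynomials and the Sobolev weight\<close>

text \<open>
Generated by monomials and sums, so that closure under products is a double induction. The normal
form with one coefficient per character is needed only once, at the end.
\<close>

inductive trig_poly :: "real \<Rightarrow> (real ^ 'd \<Rightarrow> complex) \<Rightarrow> bool" for h where
  monomial: "trig_poly h (\<lambda>\<xi>. c * character h k \<xi>)"
| add: "trig_poly h f \<Longrightarrow> trig_poly h g \<Longrightarrow> trig_poly h (\<lambda>\<xi>. f \<xi> + g \<xi>)"

lemma trig_poly_const: "trig_poly h (\<lambda>_. c)"
  using trig_poly.monomial[of h c 0] by simp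

lemma trig_poly_sum: "(\<And>i. i \<in> I \<Longrightarrow> trig_poly h (f i)) \<Longrightarrow> trig_poly h (\<lambda>\<xi>. \<Sum>i\<in>I. f i \<xi>)"
  by (induction I rule: infinite_finite_induct) (auto intro: trig_poly_const trig_poly.add)

lemma trig_poly_monomial_mult: "trig_poly h g \<Longrightarrow> trig_poly h (\<lambda>\<xi>. (c * character h k \<xi>) * g \<xi>)"
proof (induction rule: trig_poly.induct)
  case (monomial c' k')
  have "(\<lambda>\<xi>. (c * character h k \<xi>) * (c' * character h k' \<xi>)) = (\<lambda>\<xi>. (c * c') * character h (k + k') \<xi>)"
    by (simp add: character_add mult_ac)
  then show ?case by (simp only: trig_poly.monomial)
next
  case (add f g)
  then show ?case by (simp only: distrib_left trig_poly.add)
qed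

lemma trig_poly_mult: "trig_poly h f \<Longrightarrow> trig_poly h g \<Longrightarrow> trig_poly h (\<lambda>\<xi>. f \<xi> * g \<xi>)"
proof (induction rule: trig_poly.induct)
  case (add f f')
  then show ?case by (simp only: distrib_right trig_poly.add)
qed (rule trig_poly_monomial_mult)

lemma trig_poly_normal_form:
  assumes "trig_poly h f"
  shows "\<exists>K a. finite K \<and> (\<forall>\<xi>. f \<xi> = (\<Sum>k\<in>K. a k * character h k \<xi>))"
  using assms
proof (induction rule: trig_poly.induct)
  case (monomial c k)
  show ?case by (rule exI[of _ "{k}"], rule exI[of _ "\<lambda>_. c"]) simp
next
  case (add f g)
  then obtain K a L b where K: "finite K" "\<And>\<xi>. f \<xi> = (\<Sum>k\<in>K. a k * character h k \<xi>)"
    and L: "finite L" "\<And>\<xi>. g \<xi> = (\<Sum>k\<in>L. b k * character h k \<xi>)" by blast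
  have "f \<xi> + g \<xi> = (\<Sum>k\<in>K \<union> L. ((if k \<in> K then a k else 0) + (if k \<in> L then b k else 0)) * character h k \<xi>)" for \<xi>
  proof -
    have "(\<Sum>k\<in>K. a k * character h k \<xi>) = (\<Sum>k\<in>K \<union> L. (if k \<in> K then a k else 0) * character h k \<xi>)"
      "(\<Sum>k\<in>L. b k * character h k \<xi>) = (\<Sum>k\<in>K \<union> L. (if k \<in> L then b k else 0) * character h k \<xi>)"
      using K L by (auto intro!: sum.mono_neutral_cong_left)
    then show ?thesis by (simp add: K L distrib_right sum.distrib)
  qed
  then show ?case using K L by (intro exI[of _ "K \<union> L"] exI) auto
qed

text \<open>
The Fourier symbol of \<open>\<phi> \<mapsto> (1/4) \<Sum>\<^sub>k (2\<phi>(j) - \<phi>(j + 2e\<^sub>k) - \<phi>(j - 2e\<^sub>k))\<close>, and the only way in which the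
Sobolev weight depends on the frequency.
\<close>

definition sine_symbol :: "real \<Rightarrow> real ^ 'd \<Rightarrow> real" where
  "sine_symbol h \<xi> = (\<Sum>k\<in>UNIV. (sin (h * \<xi> $ k))\<^sup>2)"

lemma sine_symbol_range: "sine_symbol h (\<xi> :: real ^ 'd) \<in> {0..real CARD('d)}"
proof -
  have "sine_symbol h \<xi> \<le> (\<Sum>k\<in>(UNIV :: 'd set). 1)"
    unfolding sine_symbol_def by (intro sum_mono) (simp add: power2_eq_square abs_square_le_1[unfolded power2_eq_square])
  then show ?thesis by (auto simp: sine_symbol_def intro!: sum_nonneg)
qed

text \<open>
Because \<open>sin\<^sup>2 z = 1/2 - (e\<^bsup>2iz\<^esup> + e\<^bsup>-2iz\<^esup>)/4\<close>.
\<close>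

lemma trig_poly_sine_symbol: "trig_poly h (\<lambda>\<xi> :: real ^ 'd. of_real (sine_symbol h \<xi>))"
proof -
  have "complex_of_real ((sin (h * \<xi> $ i))\<^sup>2)
      = 1 / 2 + ((- 1 / 4) * character h (axis i 2) \<xi> + (- 1 / 4) * character h (axis i (- 2)) \<xi>)"
    for \<xi> :: "real ^ 'd" and i
  proof -
    define z where "z = complex_of_real (h * \<xi> $ i)"
    have ch: "character h (axis i n) \<xi> = exp (- \<i> * (of_int n * z))" for n
    proof -
      have "(\<Sum>m\<in>UNIV. \<xi> $ m * of_int (axis i n $ m)) = (\<Sum>m\<in>UNIV. if m = i then \<xi> $ m * of_int n else 0)"
        by (intro sum.cong) (auto simp: axis_def)
      then have "phase h \<xi> (axis i n) = of_int n * (h * \<xi> $ i)"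
        by (simp add: phase_def)
      then show ?thesis by (simp add: character_def z_def)
    qed
    have "(sin z)\<^sup>2 = (1 - cos (2 * z)) / 2" by (simp add: cos_double_sin)
    also have "cos (2 * z) = (exp (\<i> * (2 * z)) + exp (- (\<i> * (2 * z)))) / 2"
      by (simp add: cos_exp_eq)
    finally have "(sin z)\<^sup>2 = (1 - (exp (\<i> * (2 * z)) + exp (- (\<i> * (2 * z)))) / 2) / 2" .
    moreover have "complex_of_real (sin (h * \<xi> $ i)) = sin z"
      by (simp only: z_def sin_of_real)
    ultimately show ?thesis by (simp add: ch field_simps)
  qed
  then have "complex_of_real (sine_symbol h \<xi>)
      = (\<Sum>i\<in>UNIV. 1 / 2 + ((- 1 / 4) * character h (axis i 2) \<xi> + (- 1 / 4) * character h (axis i (- 2)) \<xi>))"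
    for \<xi> :: "real ^ 'd"
    unfolding sine_symbol_def of_real_sum by (intro sum.cong) auto
  then show ?thesis
    by (simp only:) (intro trig_poly_sum trig_poly.add trig_poly.monomial trig_poly_const)
qed

lemma trig_poly_polynomial_symbol:
  fixes g :: "real \<Rightarrow> real"
  assumes "real_polynomial_function g"
  shows "trig_poly h (\<lambda>\<xi> :: real ^ 'd. of_real (g (sine_symbol h \<xi>)))"
  using assms
proof (induction rule: real_polynomial_function.induct)
  case (linear f)
  then have "f x = f 1 * x" for x
    using linear_scale[of f x 1] by (simp add: bounded_linear.linear mult.commute)
  then have "(\<lambda>\<xi> :: real ^ 'd. complex_of_real (f (sine_symbol h \<xi>)))
      = (\<lambda>\<xi>. of_real (f 1) * of_real (sine_symbol h \<xi>))"
    by (metis of_real_mult)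
  then show ?case
    by (simp only: trig_poly_mult[OF trig_poly_const trig_poly_sine_symbol])
qed (simp_all add: trig_poly_const trig_poly.add trig_poly_mult)

definition weight_profile :: "real \<Rightarrow> real \<Rightarrow> real \<Rightarrow> real" where
  "weight_profile r h y = (1 + h powi (- 2) * y) powr (r / 2)"

lemma sobolev_weight_eq: "sobolev_weight r h \<xi> = weight_profile r h (sine_symbol h \<xi>)"
  by (simp add: sobolev_weight_def weight_profile_def sine_symbol_def)

lemma weight_profile_base_pos:
  fixes h y :: real
  assumes "0 < h" "0 \<le> y"
  shows "0 < 1 + h powi (- 2) * y"
  using assms by (intro add_pos_nonneg mult_nonneg_nonneg zero_le_power_int) auto

lemma continuous_weight_profile: "0 < h \<Longrightarrow> continuous_on {0..} (weight_profile r h)"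
  unfolding weight_profile_def
  by (intro continuous_intros ballI) (use weight_profile_base_pos[of h] in force)

lemma continuous_sobolev_weight:
  assumes "0 < h"
  shows "continuous_on UNIV (sobolev_weight r h :: real ^ 'd \<Rightarrow> real)"
proof -
  have "continuous_on UNIV (sine_symbol h :: real ^ 'd \<Rightarrow> real)"
    unfolding sine_symbol_def by (intro continuous_intros)
  then have "continuous_on UNIV (\<lambda>\<xi> :: real ^ 'd. weight_profile r h (sine_symbol h \<xi>))"
    by (rule continuous_on_compose2[OF continuous_weight_profile[OF assms]])
       (auto simp: sine_symbol_def intro!: sum_nonneg)
  then show ?thesis by (simp add: sobolev_weight_eq[abs_def])
qed

lemma sobolev_weight_bounded_below:
  assumes "0 < h"
  shows "\<exists>c>0. \<forall>\<xi> :: real ^ 'd. c \<le> sobolev_weight r h \<xi>"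
proof -
  have "\<exists>x\<in>{0..real CARD('d)}. \<forall>y\<in>{0..real CARD('d)}. weight_profile r h x \<le> weight_profile r h y"
    by (intro continuous_attains_inf continuous_on_subset[OF continuous_weight_profile[OF assms]]) auto
  then obtain x where x: "x \<in> {0..real CARD('d)}"
    and min: "\<And>y. y \<in> {0..real CARD('d)} \<Longrightarrow> weight_profile r h x \<le> weight_profile r h y" by blast
  have "0 < weight_profile r h x"
    using weight_profile_base_pos[OF assms, of x] x by (simp add: weight_profile_def)
  with min[OF sine_symbol_range] show ?thesis unfolding sobolev_weight_eq by blast
qed

section \<open>Square summability of Sobolev functions\<close>

lemma fourier_fin_supp:
  fixes \<phi> :: "int ^ 'd \<Rightarrow> real"
  assumes "fin_supp \<phi>"
  shows "fourier h \<phi> \<xi> = (\<Sum>k | \<phi> k \<noteq> 0. of_real (\<phi> k) * character h k \<xi>)"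
proof -
  have "fourier h \<phi> \<xi> = (\<Sum>\<^sub>\<infinity>k\<in>{k. \<phi> k \<noteq> 0}. of_real (\<phi> k) * character h k \<xi>)"
    unfolding fourier_def character_def by (rule infsum_cong_neutral) auto
  then show ?thesis using assms by (simp add: fin_supp_def infsum_finite)
qed

text \<open>
On \<open>[0, d]\<close> the weight is uniformly close to a polynomial in \<open>sine_symbol\<close>, and such a polynomial
times the transform of a finitely supported function is a trigonometric polynomial.
\<close>

lemma weighted_fourier_approx:
  fixes \<phi> :: "int ^ 'd \<Rightarrow> real"
  assumes h: "0 < h" and \<phi>: "fin_supp \<phi>" and \<delta>: "0 < \<delta>"
  shows "\<exists>K a. finite K \<and> (\<forall>\<xi>. cmod (of_real (sobolev_weight r h \<xi>) * fourier h \<phi> \<xi>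
       - (\<Sum>k\<in>K. a k * character h k \<xi>)) \<le> \<delta>)"
proof -
  define S where "S = (\<Sum>k | \<phi> k \<noteq> 0. \<bar>\<phi> k\<bar>)"
  have S: "0 \<le> S" unfolding S_def by (intro sum_nonneg) auto
  have F: "cmod (fourier h \<phi> \<xi>) \<le> S" for \<xi>
    unfolding fourier_fin_supp[OF \<phi>] S_def by (rule order_trans[OF norm_sum]) (simp add: norm_mult)
  obtain g where g: "real_polynomial_function g"
    and close: "\<And>x. x \<in> {0..real CARD('d)} \<Longrightarrow> \<bar>weight_profile r h x - g x\<bar> < \<delta> / (1 + S)"
  proof (rule Stone_Weierstrass_real_polynomial_function[of "{0..real CARD('d)}" "weight_profile r h" "\<delta> / (1 + S)"])
    show "continuous_on {0..real CARD('d)} (weight_profile r h)"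
      by (rule continuous_on_subset[OF continuous_weight_profile[OF h]]) auto
  qed (use S \<delta> in auto)
  have "trig_poly h (\<lambda>\<xi>. of_real (g (sine_symbol h \<xi>)) * fourier h \<phi> \<xi>)"
    unfolding fourier_fin_supp[OF \<phi>]
    by (intro trig_poly_mult trig_poly_polynomial_symbol g trig_poly_sum trig_poly.monomial)
  then obtain K a where K: "finite K"
    and a: "\<And>\<xi>. of_real (g (sine_symbol h \<xi>)) * fourier h \<phi> \<xi> = (\<Sum>k\<in>K. a k * character h k \<xi>)"
    using trig_poly_normal_form by blast
  have "cmod (of_real (sobolev_weight r h \<xi>) * fourier h \<phi> \<xi> - (\<Sum>k\<in>K. a k * character h k \<xi>)) \<le> \<delta>" for \<xi>
  proof -
    have "cmod (of_real (sobolev_weight r h \<xi>) * fourier h \<phi> \<xi> - (\<Sum>k\<in>K. a k * character h k \<xi>))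
        = \<bar>weight_profile r h (sine_symbol h \<xi>) - g (sine_symbol h \<xi>)\<bar> * cmod (fourier h \<phi> \<xi>)"
      unfolding a[symmetric] sobolev_weight_eq left_diff_distrib[symmetric] of_real_diff[symmetric]
      by (simp only: norm_mult norm_of_real)
    also have "\<dots> \<le> \<delta> / (1 + S) * S"
      using close[OF sine_symbol_range[of h \<xi>]] F[of \<xi>] S \<delta> by (intro mult_mono) auto
    also have "\<dots> \<le> \<delta>" using S \<delta> by (simp add: field_simps)
    finally show ?thesis .
  qed
  with K show ?thesis by blast
qed

lemma sobolev_norm_nonneg: "0 < h \<Longrightarrow> 0 \<le> sobolev_norm r h \<phi>"
  by (auto simp: sobolev_norm_def lattice_L2_norm_def intro!: mult_nonneg_nonneg infsum_nonneg)

text \<open>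
If \<open>c\<close> is a positive lower bound of the weight, then the squared Sobolev norm is at least
\<open>h\<^sup>d c\<^sup>2\<close> times the squared \<open>\<ell>\<^sup>2\<close> norm, for positive and for negative \<open>r\<close> alike. Sums over finite
sets keep the estimate stable under pointwise limits.
\<close>

lemma sobolev_norm_dominates_l2:
  assumes h: "0 < h"
  shows "\<exists>\<kappa>>0. \<forall>\<phi> :: int ^ 'd \<Rightarrow> real. fin_supp \<phi> \<longrightarrow>
           (\<forall>F. finite F \<longrightarrow> \<kappa> * (\<Sum>j\<in>F. (\<phi> j)\<^sup>2) \<le> (sobolev_norm r h \<phi>)\<^sup>2)"
proof -
  obtain c where c: "0 < c" "\<And>\<xi> :: real ^ 'd. c \<le> sobolev_weight r h \<xi>"
    using sobolev_weight_bounded_below[OF h] by blast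
  have "h ^ CARD('d) * c\<^sup>2 * (\<Sum>j\<in>F. (\<phi> j)\<^sup>2) \<le> (sobolev_norm r h \<phi>)\<^sup>2"
    if \<phi>: "fin_supp \<phi>" and F: "finite F" for \<phi> :: "int ^ 'd \<Rightarrow> real" and F
  proof -
    define G where "G \<xi> = of_real (sobolev_weight r h \<xi>) * fourier h \<phi> \<xi>" for \<xi> :: "real ^ 'd"
    have fin: "finite {k. \<phi> k \<noteq> 0}" using \<phi> by (simp add: fin_supp_def)
    have F_cont: "continuous_on UNIV (fourier h \<phi>)"
      unfolding fourier_fin_supp[OF \<phi>, abs_def] by (intro continuous_intros continuous_character)
    have G: "continuous_on UNIV G"
      unfolding G_def by (intro continuous_intros continuous_sobolev_weight h F_cont)
    have "(\<Sum>j\<in>F. (\<phi> j)\<^sup>2) \<le> (\<Sum>j\<in>F \<union> {k. \<phi> k \<noteq> 0}. (\<phi> j)\<^sup>2)"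
      using F fin by (intro sum_mono2) auto
    also have "\<dots> = (\<Sum>k | \<phi> k \<noteq> 0. (\<phi> k)\<^sup>2)"
      using F fin by (intro sum.mono_neutral_right) auto
    finally have "c\<^sup>2 * (\<Sum>j\<in>F. (\<phi> j)\<^sup>2) \<le> (\<Sum>k | \<phi> k \<noteq> 0. (cmod (of_real (c * \<phi> k)))\<^sup>2)"
      by (simp add: power_mult_distrib sum_distrib_left[symmetric] norm_mult mult_left_mono)
    also have "\<dots> = box_energy h (\<lambda>\<xi>. \<Sum>k | \<phi> k \<noteq> 0. of_real (c * \<phi> k) * character h k \<xi>)"
      by (rule box_energy_trig_sum[OF h fin, symmetric])
    also have "\<dots> = box_energy h (\<lambda>\<xi>. of_real c * fourier h \<phi> \<xi>)"
      by (simp add: fourier_fin_supp[OF \<phi>] sum_distrib_left mult.assoc)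
    also have "\<dots> \<le> box_energy h G"
    proof (intro box_energy_mono h continuous_intros F_cont G)
      show "cmod (of_real c * fourier h \<phi> \<xi>) \<le> cmod (G \<xi>)" for \<xi>
        using c(1) c(2)[of \<xi>] by (auto simp: G_def norm_mult intro!: mult_right_mono)
    qed
    also have "\<dots> \<le> (\<Sum>\<^sub>\<infinity>k. (cmod (inv_fourier h G k))\<^sup>2)"
      by (rule box_energy_le_coefficients[OF h G]) (unfold G_def, rule weighted_fourier_approx[OF h \<phi>])
    finally have *: "c\<^sup>2 * (\<Sum>j\<in>F. (\<phi> j)\<^sup>2) \<le> (\<Sum>\<^sub>\<infinity>k. (cmod (inv_fourier h G k))\<^sup>2)" .
    have "(sobolev_norm r h \<phi>)\<^sup>2 = h ^ CARD('d) * (\<Sum>\<^sub>\<infinity>k. (cmod (inv_fourier h G k))\<^sup>2)"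
      unfolding sobolev_norm_def lattice_L2_norm_def G_def[abs_def, symmetric]
      using h by (intro real_sqrt_pow2 mult_nonneg_nonneg infsum_nonneg) auto
    with * show ?thesis using h by (simp add: mult.assoc mult_left_mono)
  qed
  then show ?thesis using c h by (intro exI[of _ "h ^ CARD('d) * c\<^sup>2"]) auto
qed

text \<open>
A Cauchy sequence for the Sobolev norm is bounded in \<open>\<ell>\<^sup>2\<close>, and the bound for each finite partial
sum passes to the pointwise limit.
\<close>

theorem sobolev_space_square_summable:
  fixes u :: "int ^ 'd \<Rightarrow> real"
  assumes h: "0 < h" and u: "u \<in> sobolev_space r h"
  shows "square_summable u"
proof -
  obtain \<phi> where fin: "\<And>n. fin_supp (\<phi> n)"
    and cauchy: "\<forall>\<epsilon>>0. \<exists>N. \<forall>m\<ge>N. \<forall>n\<ge>N. sobolev_norm r h (\<lambda>j. \<phi> m j - \<phi> n j) < \<epsilon>"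
    and lim: "\<And>j. (\<lambda>n. \<phi> n j) \<longlonglongrightarrow> u j"
    using u unfolding sobolev_space_def by blast
  obtain \<kappa> where \<kappa>: "0 < \<kappa>"
    and dom: "\<And>\<phi> F. fin_supp \<phi> \<Longrightarrow> finite F \<Longrightarrow> \<kappa> * (\<Sum>j\<in>F. (\<phi> j)\<^sup>2) \<le> (sobolev_norm r h (\<phi> :: int ^ 'd \<Rightarrow> real))\<^sup>2"
    using sobolev_norm_dominates_l2[OF h] by blast
  obtain N where N: "\<And>n. n \<ge> N \<Longrightarrow> sobolev_norm r h (\<lambda>j. \<phi> n j - \<phi> N j) < 1"
    using cauchy by (metis order_refl zero_less_one)
  define M where "M = 2 / \<kappa> + 2 * (sobolev_norm r h (\<phi> N))\<^sup>2 / \<kappa>"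
  have bound: "(\<Sum>j\<in>F. (\<phi> n j)\<^sup>2) \<le> M" if "finite F" "n \<ge> N" for F n
  proof -
    have "fin_supp (\<lambda>j. \<phi> n j - \<phi> N j)"
      using fin[of n] fin[of N] unfolding fin_supp_def
      by (rule_tac finite_subset[of _ "{j. \<phi> n j \<noteq> 0} \<union> {j. \<phi> N j \<noteq> 0}"]) auto
    from dom[OF this \<open>finite F\<close>]
    have "\<kappa> * (\<Sum>j\<in>F. (\<phi> n j - \<phi> N j)\<^sup>2) \<le> (sobolev_norm r h (\<lambda>j. \<phi> n j - \<phi> N j))\<^sup>2" .
    also have "\<dots> \<le> 1"
      using N[OF that(2)] sobolev_norm_nonneg[OF h, of r "\<lambda>j. \<phi> n j - \<phi> N j"] by (simp add: power_le_one)
    finally have 1: "(\<Sum>j\<in>F. (\<phi> n j - \<phi> N j)\<^sup>2) \<le> 1 / \<kappa>" using \<kappa> by (simp add: field_simps)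
    have 2: "(\<Sum>j\<in>F. (\<phi> N j)\<^sup>2) \<le> (sobolev_norm r h (\<phi> N))\<^sup>2 / \<kappa>"
      using dom[OF fin[of N] \<open>finite F\<close>] \<kappa> by (simp add: field_simps)
    have "(\<Sum>j\<in>F. (\<phi> n j)\<^sup>2) \<le> (\<Sum>j\<in>F. 2 * (\<phi> n j - \<phi> N j)\<^sup>2 + 2 * (\<phi> N j)\<^sup>2)"
    proof (rule sum_mono)
      fix j
      have "0 \<le> (\<phi> n j - 2 * \<phi> N j)\<^sup>2" by simp
      then show "(\<phi> n j)\<^sup>2 \<le> 2 * (\<phi> n j - \<phi> N j)\<^sup>2 + 2 * (\<phi> N j)\<^sup>2"
        by (simp add: power2_eq_square algebra_simps)
    qed
    also have "\<dots> \<le> M" using 1 2 by (simp add: M_def sum.distrib sum_distrib_left[symmetric])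
    finally show ?thesis .
  qed
  have "(\<Sum>j\<in>F. (u j)\<^sup>2) \<le> M" if F: "finite F" for F
  proof (rule tendsto_upperbound)
    show "(\<lambda>n. \<Sum>j\<in>F. (\<phi> n j)\<^sup>2) \<longlonglongrightarrow> (\<Sum>j\<in>F. (u j)\<^sup>2)"
      by (intro tendsto_intros lim)
    show "\<forall>\<^sub>F n in sequentially. (\<Sum>j\<in>F. (\<phi> n j)\<^sup>2) \<le> M"
      using eventually_ge_at_top[of N] by eventually_elim (rule bound[OF F])
  qed simp
  then show ?thesis
    unfolding square_summable_def
    by (intro nonneg_bdd_above_summable_on) (auto intro!: bdd_aboveI2)
qed

section \<open>The resolvent applied to a square-summable function\<close>

definition resolvent :: "real \<Rightarrow> (int ^ 'd \<Rightarrow> real) \<Rightarrow> int ^ 'd \<Rightarrow> real" where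
  "resolvent \<mu> u j = (\<Sum>\<^sub>\<infinity>m. resolvent_kernel \<mu> (j - m) * u m)"

lemma resolvent_square_summable:
  assumes "0 < \<mu>" "square_summable u"
  shows "square_summable (resolvent \<mu> u)"
  unfolding resolvent_def
  by (rule convolution_square_summable) (auto simp: assms summable_resolvent_kernel resolvent_kernel_nonneg)

lemma shifted_laplacian_resolvent:
  fixes u :: "int ^ 'd \<Rightarrow> real"
  assumes "0 < \<mu>" "square_summable u"
  shows "shifted_laplacian \<mu> (resolvent \<mu> u) j = u j"
proof -
  let ?R = "resolvent_kernel \<mu> :: int ^ 'd \<Rightarrow> real"
  have R: "((\<lambda>m. ?R (n - m) * u m) has_sum resolvent \<mu> u n) UNIV" for n
    unfolding resolvent_def using assms
    by (intro has_sum_infsum convolution_summable(1)) (auto simp: summable_resolvent_kernel resolvent_kernel_nonneg)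
  have "((\<lambda>m. (\<mu> + 2 * real CARD('d)) * (?R (j - m) * u m)
       - (\<Sum>i\<in>UNIV. ?R (j + axis i 1 - m) * u m + ?R (j - axis i 1 - m) * u m))
      has_sum shifted_laplacian \<mu> (resolvent \<mu> u) j) UNIV"
    unfolding shifted_laplacian_def
    by (intro has_sum_diff has_sum_finite_sum has_sum_add has_sum_cmult_right R)
  moreover have "(\<mu> + 2 * real CARD('d)) * (?R (j - m) * u m)
       - (\<Sum>i\<in>UNIV. ?R (j + axis i 1 - m) * u m + ?R (j - axis i 1 - m) * u m)
      = (if m = j then u j else 0)" for m
  proof -
    have shift: "j + axis i 1 - m = (j - m) + axis i 1" "j - axis i 1 - m = (j - m) - axis i 1" for i
      by (simp_all add: algebra_simps)
    have "(\<mu> + 2 * real CARD('d)) * (?R (j - m) * u m)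
       - (\<Sum>i\<in>UNIV. ?R (j + axis i 1 - m) * u m + ?R (j - axis i 1 - m) * u m)
      = ((\<mu> + 2 * real CARD('d)) * ?R (j - m)
         - (\<Sum>i\<in>UNIV. ?R ((j - m) + axis i 1) + ?R ((j - m) - axis i 1))) * u m"
      unfolding shift by (simp add: left_diff_distrib sum_distrib_right distrib_right mult.assoc)
    then show ?thesis unfolding resolvent_equation[OF assms(1)] by auto
  qed
  ultimately have "((\<lambda>m. if m = j then u j else 0) has_sum shifted_laplacian \<mu> (resolvent \<mu> u) j) UNIV"
    by simp
  moreover have "((\<lambda>m. if m = j then u j else 0) has_sum u j) UNIV"
    by (rule has_sum_cong_neutral[THEN iffD1, OF _ _ _ has_sum_finiteI[of "{j}"]]) auto
  ultimately show ?thesis by (rule has_sum_unique)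
qed

text \<open>
The kernel has total mass at most \<open>1/\<mu>\<close>. The decay for large \<open>\<mu>\<close> is what finally forces \<open>u\<close> to
vanish on each new layer.
\<close>

lemma resolvent_bound:
  fixes u :: "int ^ 'd \<Rightarrow> real"
  assumes "0 < \<mu>" "square_summable u" "\<And>j. \<bar>u j\<bar> \<le> B"
  shows "\<bar>resolvent \<mu> u j\<bar> \<le> B / \<mu>"
proof -
  let ?R = "resolvent_kernel \<mu> :: int ^ 'd \<Rightarrow> real"
  have B: "0 \<le> B" using assms(3)[of 0] by linarith
  have S: "(\<lambda>m. ?R (j - m) * \<bar>u m\<bar>) summable_on UNIV"
    using assms by (intro convolution_summable(2)) (auto simp: summable_resolvent_kernel resolvent_kernel_nonneg)
  have "\<bar>resolvent \<mu> u j\<bar> \<le> (\<Sum>\<^sub>\<infinity>m. ?R (j - m) * \<bar>u m\<bar>)"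
    unfolding resolvent_def
    using norm_infsum_bound[of "\<lambda>m. ?R (j - m) * u m" UNIV] S by (simp add: abs_mult resolvent_kernel_nonneg)
  also have "\<dots> \<le> B / \<mu>"
  proof (rule infsum_le_finite_sums[OF S])
    fix F :: "(int ^ 'd) set" assume F: "finite F"
    have "(\<Sum>m\<in>F. ?R (j - m) * \<bar>u m\<bar>) \<le> (\<Sum>m\<in>F. ?R (j - m) * B)"
      by (intro sum_mono mult_left_mono assms resolvent_kernel_nonneg)
    also have "\<dots> = sum ?R ((\<lambda>m. j - m) ` F) * B"
      by (subst sum.reindex) (auto simp: inj_on_def sum_distrib_right)
    also have "\<dots> \<le> 1 / \<mu> * B"
      using F assms(1) B by (intro mult_right_mono sum_resolvent_kernel_le) auto
    finally show "(\<Sum>m\<in>F. ?R (j - m) * \<bar>u m\<bar>) \<le> B / \<mu>" by simp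
  qed
  finally show ?thesis .
qed

text \<open>
If \<open>f\<close> vanishes on the layer of \<open>j\<close> and above it, the only neighbour of \<open>j\<close> that can contribute
is the one below it.
\<close>

lemma shifted_laplacian_below_slab:
  fixes f :: "int ^ 'd \<Rightarrow> real"
  assumes "\<And>i. j $ l \<le> i $ l \<Longrightarrow> f i = 0"
  shows "shifted_laplacian \<mu> f j = - f (j - axis l 1)"
proof -
  have "(\<Sum>i\<in>UNIV - {l}. f (j + axis i 1) + f (j - axis i 1)) = 0"
    by (intro sum.neutral ballI) (auto simp: assms axis_def)
  then show ?thesis
    unfolding shifted_laplacian_def sum.remove[of UNIV l, OF finite UNIV_I]
    by (simp add: assms axis_def)
qed

section \<open>Interchanging the frequency integral and the lattice sum\<close>

text \<open>
Fubini's theorem for a counting measure, reduced to series by enumerating the index type.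
\<close>

lemma integral_infsum:
  fixes f :: "'a :: countable \<Rightarrow> 'b \<Rightarrow> real"
  assumes inf: "infinite (UNIV :: 'a set)"
    and int: "\<And>a. integrable M (f a)"
    and pointwise: "\<And>x. (\<lambda>a. f a x) summable_on UNIV"
    and norms: "(\<lambda>a. LINT x|M. \<bar>f a x\<bar>) summable_on UNIV"
  shows "integrable M (\<lambda>x. \<Sum>\<^sub>\<infinity>a. f a x)" (is ?thesis1)
    and "(LINT x|M. (\<Sum>\<^sub>\<infinity>a. f a x)) = (\<Sum>\<^sub>\<infinity>a. LINT x|M. f a x)" (is ?thesis2)
proof -
  define p where "p = from_nat_into (UNIV :: 'a set)"
  have p: "bij_betw p UNIV UNIV"
    unfolding p_def by (rule bij_betw_from_nat_into) (auto simp: inf)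
  have nat_sums: "summable (\<lambda>n. \<bar>g (p n)\<bar>)" "(\<Sum>n. g (p n)) = (\<Sum>\<^sub>\<infinity>a. g a)"
    if "g summable_on UNIV" for g :: "'a \<Rightarrow> real"
  proof -
    have "(\<lambda>n. g (p n)) summable_on UNIV" 
      using that by (subst summable_on_reindex_bij_betw[OF p])
    then have "(\<lambda>n. \<bar>g (p n)\<bar>) summable_on UNIV"
      using summable_on_iff_abs_summable_on_real[of "\<lambda>n. g (p n)"] by simp
    then show "summable (\<lambda>n. \<bar>g (p n)\<bar>)"
      using has_sum_imp_sums[OF has_sum_infsum] by (auto simp: sums_iff)
    have "(\<lambda>n. g (p n)) sums (\<Sum>\<^sub>\<infinity>n. g (p n))"
      using \<open>(\<lambda>n. g (p n)) summable_on UNIV\<close> by (intro has_sum_imp_sums has_sum_infsum)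
    then show "(\<Sum>n. g (p n)) = (\<Sum>\<^sub>\<infinity>a. g a)"
      by (simp add: sums_iff infsum_reindex_bij_betw[OF p])
  qed
  have eq: "(\<Sum>\<^sub>\<infinity>a. f a x) = (\<Sum>n. f (p n) x)" for x
    using nat_sums(2)[OF pointwise[of x]] by simp
  have AE: "AE x in M. summable (\<lambda>n. norm (f (p n) x))"
    using nat_sums(1)[OF pointwise] by simp
  have sm: "summable (\<lambda>n. LINT x|M. norm (f (p n) x))"
    using nat_sums(1)[OF norms] by simp
  show ?thesis1 unfolding eq by (rule integrable_suminf[OF int AE sm])
  have "(\<lambda>a. LINT x|M. f a x) summable_on UNIV"
  proof (rule abs_summable_summable, rule summable_on_comparison_test[OF norms])
    show "norm (LINT x|M. f a x) \<le> (LINT x|M. \<bar>f a x\<bar>)" for a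
      using integral_norm_bound[of M "f a"] by simp
  qed auto
  then show ?thesis2
    unfolding eq by (simp add: integral_suminf[OF int AE sm] nat_sums(2)[symmetric])
qed

text \<open>
The double series is dominated by \<open>f(j - m) (a(j)\<^sup>2 + b(m)\<^sup>2)\<close>, and the sum of this over all pairs is
\<open>\<parallel>f\<parallel>\<^sub>1 (\<parallel>a\<parallel>\<^sup>2 + \<parallel>b\<parallel>\<^sup>2)\<close>. It is used with the fractional kernel and with the resolvent kernels.
\<close>

lemma sandwich_summable:
  fixes f a b :: "int ^ 'd \<Rightarrow> real"
  assumes f: "f summable_on UNIV" "\<And>j. 0 \<le> f j" and a: "square_summable a" and b: "square_summable b"
  shows "(\<lambda>(j, m). \<bar>a j * (f (j - m) * b m)\<bar>) summable_on UNIV"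
    and "(\<lambda>(j, m). a j * (f (j - m) * b m)) summable_on UNIV"
    and "(\<Sum>\<^sub>\<infinity>(j, m). a j * (f (j - m) * b m)) = (\<Sum>\<^sub>\<infinity>j. a j * (\<Sum>\<^sub>\<infinity>m. f (j - m) * b m))"
proof -
  have fm: "(\<lambda>j. f (- j)) summable_on UNIV"
    using f(1) by (subst summable_on_reindex_bij_witness[where i = uminus and j = uminus and T = UNIV and h = f]) auto
  have "(\<lambda>(m, j). f (- (m - j)) * (a j)\<^sup>2) summable_on UNIV"
    using convolution_pairs_summable[OF fm, of "\<lambda>j. (a j)\<^sup>2"] f a by (simp add: square_summable_def)
  then have "(\<lambda>(j, m). f (j - m) * (a j)\<^sup>2) summable_on UNIV \<times> UNIV"
    by (subst summable_on_swap) (simp add: case_prod_unfold)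
  moreover have "(\<lambda>(j, m). f (j - m) * (b m)\<^sup>2) summable_on UNIV"
    using convolution_pairs_summable[OF f, of "\<lambda>j. (b j)\<^sup>2"] b by (simp add: square_summable_def)
  ultimately have "(\<lambda>p. (case p of (j, m) \<Rightarrow> f (j - m) * (a j)\<^sup>2) + (case p of (j, m) \<Rightarrow> f (j - m) * (b m)\<^sup>2))
      summable_on UNIV"
    by (intro summable_on_add) auto
  then show abs: "(\<lambda>(j, m). \<bar>a j * (f (j - m) * b m)\<bar>) summable_on UNIV"
  proof (rule summable_on_comparison_test)
    fix p :: "(int ^ 'd) \<times> (int ^ 'd)"
    obtain j m where p: "p = (j, m)" by force
    have "2 * (\<bar>a j\<bar> * \<bar>b m\<bar>) \<le> (a j)\<^sup>2 + (b m)\<^sup>2"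
      using sum_squares_bound[of "\<bar>a j\<bar>" "\<bar>b m\<bar>"] by simp
    then have "\<bar>a j\<bar> * \<bar>b m\<bar> \<le> (a j)\<^sup>2 + (b m)\<^sup>2"
      using mult_nonneg_nonneg[of "\<bar>a j\<bar>" "\<bar>b m\<bar>"] by linarith
    then have "f (j - m) * (\<bar>a j\<bar> * \<bar>b m\<bar>) \<le> f (j - m) * ((a j)\<^sup>2 + (b m)\<^sup>2)"
      by (intro mult_left_mono f)
    then show "(case p of (j, m) \<Rightarrow> \<bar>a j * (f (j - m) * b m)\<bar>)
       \<le> (case p of (j, m) \<Rightarrow> f (j - m) * (a j)\<^sup>2) + (case p of (j, m) \<Rightarrow> f (j - m) * (b m)\<^sup>2)"
      using f by (simp add: p abs_mult algebra_simps)
  qed auto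
  then show sm: "(\<lambda>(j, m). a j * (f (j - m) * b m)) summable_on UNIV"
    by (rule_tac abs_summable_summable) (simp add: case_prod_unfold)
  have sm': "(\<lambda>(j, m). a j * (f (j - m) * b m)) summable_on UNIV \<times> UNIV"
    using sm by simp
  show "(\<Sum>\<^sub>\<infinity>(j, m). a j * (f (j - m) * b m)) = (\<Sum>\<^sub>\<infinity>j. a j * (\<Sum>\<^sub>\<infinity>m. f (j - m) * b m))"
    using infsum_Sigma'_banach[OF sm'] by (simp add: infsum_cmult_right')
qed

section \<open>Unique continuation\<close>

text \<open>
Where \<open>u\<close> itself vanishes, the fractional Laplacian is minus the convolution with the kernel.
\<close>

lemma frac_laplacian_vanishing:
  fixes u :: "int ^ 'd \<Rightarrow> real"
  assumes "u j = 0" "frac_laplacian h s u j = 0"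
  shows "(\<Sum>\<^sub>\<infinity>m. frac_kernel h s (j - m) * u m) = 0"
proof -
  have "(\<Sum>\<^sub>\<infinity>m. frac_kernel h s (j - m) * u m) = (\<Sum>\<^sub>\<infinity>m\<in>UNIV - {j}. frac_kernel h s (j - m) * u m)"
    by (rule infsum_cong_neutral) (auto simp: frac_kernel_def)
  also have "\<dots> = (\<Sum>\<^sub>\<infinity>m\<in>UNIV - {j}. - ((u j - u m) * frac_kernel h s (j - m)))"
    by (intro infsum_cong) (simp add: assms)
  also have "\<dots> = - frac_laplacian h s u j"
    unfolding frac_laplacian_def by (rule infsum_uminus)
  finally show ?thesis using assms by simp
qed

text \<open>
The double series \<open>\<Sum>\<^sub>j \<Sum>\<^sub>m u(Rj) u(m) k(j - m)\<close> with the fractional kernel \<open>k\<close> vanishes: where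
\<open>u(Rj) \<noteq> 0\<close>, the point \<open>j\<close> lies in the half-space, and there the inner sum is zero by assumption.
Subordination may be inserted under the sum because the terms with \<open>u(Rj) u(m) \<noteq> 0\<close> have \<open>j\<close> and
\<open>m\<close> on different sides of the hyperplane and so avoid the diagonal.
\<close>

lemma reflected_pairing_integral:
  fixes u :: "int ^ 'd \<Rightarrow> real"
  assumes "h > 0" "0 < s" "s < 1" and u: "square_summable u"
    and zero: "\<And>j. 0 \<le> j $ l \<Longrightarrow> u j = 0 \<and> frac_laplacian h s u j = 0"
  defines "q \<equiv> \<lambda>\<mu>. \<Sum>\<^sub>\<infinity>j. u (reflect l j) * resolvent \<mu> u j"
  shows "integrable lborel (\<lambda>\<mu>. indicator {0<..} \<mu> * (\<mu> powr s * q \<mu>))"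
    and "(LINT \<mu>|lborel. indicator {0<..} \<mu> * (\<mu> powr s * q \<mu>)) = 0"
proof -
  define C where "C = Gamma (1 + s) * h powr (2 * s) * \<bar>Gamma (- s)\<bar>"
  define a where "a j = u (reflect l j)" for j
  have a: "square_summable a"
    unfolding a_def by (rule square_summable_bij[OF u bij_reflect])
  have off_diag: "j - m \<noteq> 0" if "a j * u m \<noteq> 0" for j m
    using that zero[of "reflect l j"] zero[of m] by (cases "0 \<le> m $ l") (auto simp: a_def)
  let ?i = "indicator {0<..} :: real \<Rightarrow> real"
  let ?f = "\<lambda>(j, m) \<mu>. ?i \<mu> * (\<mu> powr s * (a j * (resolvent_kernel \<mu> (j - m) * u m)))"
  have f_eq: "?f (j, m) \<mu> = (a j * u m) * (?i \<mu> *\<^sub>R (\<mu> powr s * resolvent_kernel \<mu> (j - m)))" for j m \<mu>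
    by simp
  have abs_f_eq: "\<bar>?f (j, m) \<mu>\<bar> = \<bar>a j * u m\<bar> * (?i \<mu> *\<^sub>R (\<mu> powr s * resolvent_kernel \<mu> (j - m)))" for j m \<mu>
    by (simp add: abs_mult resolvent_kernel_nonneg)
  have base_int: "integrable lborel (\<lambda>\<mu>. ?i \<mu> *\<^sub>R (\<mu> powr s * resolvent_kernel \<mu> (j - m)))"
    and base: "(LINT \<mu>|lborel. ?i \<mu> *\<^sub>R (\<mu> powr s * resolvent_kernel \<mu> (j - m))) = C * frac_kernel h s (j - m)"
    if "a j * u m \<noteq> 0" for j m
    using resolvent_subordination(1)[OF assms(2,3) off_diag[OF that]]
      frac_kernel_subordination[OF assms(1,2,3) off_diag[OF that]]
    by (simp_all add: set_integrable_def set_lebesgue_integral_def C_def)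
  have int: "integrable lborel (?f p)" for p
  proof (cases p)
    case (Pair j m)
    show ?thesis
    proof (cases "a j * u m = 0")
      case False
      then show ?thesis unfolding Pair f_eq by (intro integrable_mult_right base_int)
    next
      case True
      show ?thesis unfolding Pair f_eq True using True by auto
    qed
  qed
  have integral_f: "(LINT \<mu>|lborel. ?f p \<mu>) = C * (case p of (j, m) \<Rightarrow> a j * (frac_kernel h s (j - m) * u m))" for p
  proof (cases p)
    case (Pair j m)
    show ?thesis
    proof (cases "a j * u m = 0")
      case False
      then show ?thesis unfolding Pair f_eq integral_mult_right_zero base[OF False] by simp
    next
      case True
      show ?thesis unfolding Pair f_eq True using True by auto
    qed
  qed
  have integral_abs_f: "(LINT \<mu>|lborel. \<bar>?f p \<mu>\<bar>) = C * (case p of (j, m) \<Rightarrow> \<bar>a j * (frac_kernel h s (j - m) * u m)\<bar>)" for p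
  proof (cases p)
    case (Pair j m)
    show ?thesis
    proof (cases "a j * u m = 0")
      case False
      then show ?thesis unfolding Pair abs_f_eq integral_mult_right_zero base[OF False]
        by (simp add: abs_mult frac_kernel_nonneg)
    next
      case True
      show ?thesis unfolding Pair abs_f_eq True using True by auto
    qed
  qed
  have K: "(frac_kernel h s :: int ^ 'd \<Rightarrow> real) summable_on UNIV"
    by (rule summable_frac_kernel[OF assms(2,3)])
  have norms: "(\<lambda>p. LINT \<mu>|lborel. \<bar>?f p \<mu>\<bar>) summable_on UNIV"
    unfolding integral_abs_f using sandwich_summable(1)[OF K frac_kernel_nonneg a u]
    by (rule summable_on_cmult_right)
  have pointwise: "(\<lambda>p. ?f p \<mu>) summable_on UNIV"
    and sum: "(\<Sum>\<^sub>\<infinity>p. ?f p \<mu>) = ?i \<mu> * (\<mu> powr s * q \<mu>)" for \<mu>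
  proof -
    have "(\<lambda>p. ?f p \<mu>) summable_on UNIV \<and> (\<Sum>\<^sub>\<infinity>p. ?f p \<mu>) = ?i \<mu> * (\<mu> powr s * q \<mu>)"
    proof (cases "0 < \<mu>")
      case True
      note R = sandwich_summable[OF summable_resolvent_kernel[OF True] resolvent_kernel_nonneg a u]
      have eq: "?f p \<mu> = (?i \<mu> * \<mu> powr s) * (case p of (j, m) \<Rightarrow> a j * (resolvent_kernel \<mu> (j - m) * u m))" for p
        by (cases p) simp
      show ?thesis
        unfolding eq q_def resolvent_def a_def[symmetric]
        using summable_on_cmult_right[OF R(2), of "?i \<mu> * \<mu> powr s"]
        by (simp only: infsum_cmult_right' R(3)) simp
    qed (auto simp: case_prod_unfold)
    then show "(\<lambda>p. ?f p \<mu>) summable_on UNIV" "(\<Sum>\<^sub>\<infinity>p. ?f p \<mu>) = ?i \<mu> * (\<mu> powr s * q \<mu>)"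
      by blast+
  qed
  have inf: "infinite (UNIV :: ((int ^ 'd) \<times> (int ^ 'd)) set)"
  proof -
    have "inj (\<lambda>k. (axis l k :: int ^ 'd, 0 :: int ^ 'd))" by (auto simp: inj_on_def axis_eq_axis)
    then show ?thesis using infinite_UNIV_int finite_imageD[of "\<lambda>k. (axis l k :: int ^ 'd, 0 :: int ^ 'd)" UNIV]
      by (meson finite_subset subset_UNIV)
  qed
  note swap = integral_infsum[OF inf int pointwise norms]
  show "integrable lborel (\<lambda>\<mu>. ?i \<mu> * (\<mu> powr s * q \<mu>))"
    using swap(1) unfolding sum .
  have "(LINT \<mu>|lborel. ?i \<mu> * (\<mu> powr s * q \<mu>))
      = C * (\<Sum>\<^sub>\<infinity>(j, m). a j * (frac_kernel h s (j - m) * u m))"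
    using swap(2) unfolding sum integral_f infsum_cmult_right' .
  also have "(\<Sum>\<^sub>\<infinity>(j, m). a j * (frac_kernel h s (j - m) * u m))
      = (\<Sum>\<^sub>\<infinity>j. a j * (\<Sum>\<^sub>\<infinity>m. frac_kernel h s (j - m) * u m))"
    by (rule sandwich_summable(3)[OF K frac_kernel_nonneg a u])
  also have "\<dots> = 0"
  proof (rule infsum_0)
    fix j :: "int ^ 'd"
    show "a j * (\<Sum>\<^sub>\<infinity>m. frac_kernel h s (j - m) * u m) = 0"
    proof (cases "0 \<le> j $ l")
      case True
      then show ?thesis using frac_laplacian_vanishing[of u j h s] zero[of j] by simp
    next
      case False
      then show ?thesis using zero[of "reflect l j"] by (simp add: a_def)
    qed
  qed
  finally show "(LINT \<mu>|lborel. ?i \<mu> * (\<mu> powr s * q \<mu>)) = 0" by simp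
qed

lemma resolvent_vanishes_AE:
  fixes u :: "int ^ 'd \<Rightarrow> real"
  assumes "h > 0" "0 < s" "s < 1" and u: "square_summable u"
    and zero: "\<And>j. 0 \<le> j $ l \<Longrightarrow> u j = 0 \<and> frac_laplacian h s u j = 0"
  shows "AE \<mu> in lborel. 0 < \<mu> \<longrightarrow> (\<forall>j. 0 \<le> j $ l \<longrightarrow> resolvent \<mu> u j = 0)"
proof -
  define q where "q \<mu> = (\<Sum>\<^sub>\<infinity>j. u (reflect l j) * resolvent \<mu> u j)" for \<mu>
  note Q = reflected_pairing_integral[where l = l, OF assms(1-4), folded q_def]
  have pos: "2 * \<mu> * (\<Sum>\<^sub>\<infinity>j. if 0 \<le> j $ l then (resolvent \<mu> u j)\<^sup>2 else 0) \<le> q \<mu>" if "0 < \<mu>" for \<mu>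
    using reflection_positivity[OF resolvent_square_summable[OF that u], of l \<mu>] zero
    by (simp add: shifted_laplacian_resolvent[OF that u] q_def)
  have norm_nonneg: "0 \<le> (\<Sum>\<^sub>\<infinity>j. if 0 \<le> j $ l then (resolvent \<mu> u j)\<^sup>2 else 0)" for \<mu>
    by (intro infsum_nonneg) auto
  have q_nonneg: "0 \<le> q \<mu>" if "0 < \<mu>" for \<mu>
    using pos[OF that] norm_nonneg[of \<mu>] that
    by (meson mult_nonneg_nonneg less_imp_le order_trans zero_le_numeral)
  have "AE \<mu> in lborel. indicator {0<..} \<mu> * (\<mu> powr s * q \<mu>) = 0"
    using zero Q by (subst integral_nonneg_eq_0_iff_AE[symmetric])
      (auto intro!: AE_I2 simp: indicator_def q_nonneg)
  then show ?thesis
  proof eventually_elim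
    fix \<mu> :: real
    assume *: "indicator {0<..} \<mu> * (\<mu> powr s * q \<mu>) = 0"
    show "0 < \<mu> \<longrightarrow> (\<forall>j. 0 \<le> j $ l \<longrightarrow> resolvent \<mu> u j = 0)"
    proof (intro impI allI)
      fix j :: "int ^ 'd" assume \<mu>: "0 < \<mu>" and j: "0 \<le> j $ l"
      let ?g = "\<lambda>j. if 0 \<le> j $ l then (resolvent \<mu> u j)\<^sup>2 else 0"
      have "q \<mu> = 0" using * \<mu> by simp
      then have "2 * \<mu> * infsum ?g UNIV \<le> 0" using pos[OF \<mu>] by simp
      then have "infsum ?g UNIV \<le> 0" using \<mu> by (simp add: mult_le_0_iff)
      moreover have "?g summable_on UNIV"
        using resolvent_square_summable[OF \<mu> u] unfolding square_summable_def
        by (rule summable_on_comparison_test) auto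
      ultimately have "?g j = 0" by (intro nonneg_infsum_le_0D[of ?g UNIV]) auto
      with j show "resolvent \<mu> u j = 0" by simp
    qed
  qed
qed

lemma AE_positive_unbounded:
  assumes "AE x in lborel. P (x :: real)"
  shows "\<exists>x>M. P x"
proof (rule ccontr)
  assume "\<not> (\<exists>x>M. P x)"
  with assms have "AE x in lborel. x \<notin> {M<..M + 1}" by (auto elim!: eventually_mono)
  then have "emeasure lborel {M<..M + 1} = 0"
    by (subst (asm) AE_iff_measurable[of "{M<..M + 1}"]) auto
  then show False by simp
qed

text \<open>
Both \<open>u\<close> and its resolvents are shown to vanish one layer further down at a time. Almost every
\<open>\<mu> > 0\<close> is good, so there are arbitrarily large good \<open>\<mu>\<close>; this is all that the descent needs.
\<close>

theorem square_summable_unique_continuation: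
  fixes u :: "int ^ 'd \<Rightarrow> real"
  assumes "h > 0" "0 < s" "s < 1" and u: "square_summable u"
    and zero: "\<And>j. 0 \<le> j $ l \<Longrightarrow> u j = 0 \<and> frac_laplacian h s u j = 0"
  shows "u j = 0"
proof -
  define good where "good = {\<mu>. 0 < \<mu> \<and> (\<forall>j. 0 \<le> j $ l \<longrightarrow> resolvent \<mu> u j = 0)}"
  have unbounded: "\<exists>\<mu>\<in>good. M < \<mu>" for M
  proof -
    obtain \<mu> where "max M 0 < \<mu>" "0 < \<mu> \<longrightarrow> (\<forall>j. 0 \<le> j $ l \<longrightarrow> resolvent \<mu> u j = 0)"
      using AE_positive_unbounded[OF resolvent_vanishes_AE[of h s u l], of "max M 0"] assms by blast
    then show ?thesis by (auto simp: good_def)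
  qed
  obtain B where B: "\<And>j. \<bar>u j\<bar> \<le> B" using square_summable_bounded[OF u] by blast
  have "\<forall>j. - int n \<le> j $ l \<longrightarrow> u j = 0 \<and> (\<forall>\<mu>\<in>good. resolvent \<mu> u j = 0)" for n
  proof (induction n)
    case 0
    then show ?case using zero by (auto simp: good_def)
  next
    case (Suc n)
    have v: "resolvent \<mu> u j = 0" if "- int (Suc n) \<le> j $ l" "\<mu> \<in> good" for j \<mu>
    proof (cases "- int n \<le> j $ l")
      case False
      let ?k = "j + axis l 1"
      have k: "?k $ l = - int n" using that False by (simp add: axis_def)
      have "0 < \<mu>" using that(2) by (simp add: good_def)
      have "shifted_laplacian \<mu> (resolvent \<mu> u) ?k = - resolvent \<mu> u (?k - axis l 1)"
        by (rule shifted_laplacian_below_slab) (use k Suc.IH that(2) in auto)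
      then show ?thesis
        using Suc.IH k by (simp add: shifted_laplacian_resolvent[OF \<open>0 < \<mu>\<close> u])
    qed (use Suc.IH that in auto)
    have "u j = 0" if "- int (Suc n) \<le> j $ l" for j
    proof (rule ccontr)
      assume "u j \<noteq> 0"
      \<comment> \<open>for such \<open>\<mu>\<close> the bound \<open>B / \<mu>\<close> on the resolvent is smaller than \<open>\<bar>u j\<bar>\<close>\<close>
      obtain \<mu> where \<mu>: "\<mu> \<in> good" "B / \<bar>u j\<bar> < \<mu>" using unbounded by blast
      then have "0 < \<mu>" by (simp add: good_def)
      have "shifted_laplacian \<mu> (resolvent \<mu> u) j = - resolvent \<mu> u (j - axis l 1)"
        by (rule shifted_laplacian_below_slab) (use that v[OF _ \<mu>(1)] in auto)
      then have "u j = - resolvent \<mu> u (j - axis l 1)"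
        by (simp add: shifted_laplacian_resolvent[OF \<open>0 < \<mu>\<close> u])
      then have "\<bar>u j\<bar> \<le> B / \<mu>" using resolvent_bound[OF \<open>0 < \<mu>\<close> u B, of "j - axis l 1"] by simp
      with \<mu>(2) \<open>0 < \<mu>\<close> \<open>u j \<noteq> 0\<close> show False by (simp add: field_simps)
    qed
    with v show ?case by blast
  qed
  from this[of "nat (- (j $ l))"] show ?thesis by auto
qed

theorem proposition1p2:
  fixes h r s :: real and u :: "int ^ 'd \<Rightarrow> real" and l :: "'d::finite"
  assumes "h > 0"
    and "u \<in> sobolev_space r h"
    and "0 < s" and "s < 1"
    and "\<forall>j. h * of_int (j $ l) \<ge> 0 \<longrightarrow> u j = 0 \<and> frac_laplacian h s u j = 0"
  shows "\<forall>j. u j = 0"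
proof
  fix j
  have zero: "u j = 0 \<and> frac_laplacian h s u j = 0" if "0 \<le> j $ l" for j
    using assms(1,5) that by simp
  show "u j = 0"
    by (rule square_summable_unique_continuation[OF assms(1,3,4)
          sobolev_space_square_summable[OF assms(1,2)] zero])
qed

end
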